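(* Let $G$ be an abelian group, let $n\geq 1$, and let $S\in \mathcal F(G)$ be a sequence with $|S|>n$. Let $m=\min\{n,\,|S|-n,\,|S|-\mathsf h(S)\}$ and suppose $|\Sigma_n(S)|\leq m+1$. Then one of the following holds, where Items 1–4 are only possible if $|\Sigma_n(S)|=m+1$ or $|\mathrm{supp}(S)|=1$: 1. $n=2$, $|S|=|\mathrm{supp}(S)|$, and $\mathrm{supp}(S)=x+K$ for some subgroup $K\leq G$ and $x\in G$ with $K\cong (\mathbb Z/2\mathbb Z)^2$. 2. $m=2$ and $\mathrm{supp}(S)=x+K$ for some subgroup $K\leq G$ and $x\in G$ with $K\cong \mathbb Z/3\mathbb Z$. 3. $|\mathrm{supp}(S)|\leq 2$. 4. $\mathrm{supp}(S)\subseteq \{x-d,x,x+d\}$ for some $x,d\in G$ with $\mathsf v_x(S)=\mathsf h(S)\geq |S|-m$. 5. There exist $x\in G$ and a setpartition $\mathscr A=A_1\cdot\ldots\cdot A_n$ with $\mathsf S(\mathscr A)\mid S$, $|\mathsf S(\mathscr A)|=n+m$, $\sum_{i=1}^{n}A_i=\Sigma_n(S)$, $\mathrm{supp}(\mathsf S(\mathscr A)^{[-1]}\cdot S)\subseteq x+H$, $|A_i|\leq 2$ and $(x+H)\cap A_i\neq \emptyset$ for all $i\in [1,n]$, and $|\sum_{i=1}^{n}A_i|=|\sum_{i\in[1,n],\,i\neq j}A_i|$ for some $j\in [1,n]$, where $H=\mathsf H(\Sigma_n(S))$ is nontrivial.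
   Context: A sequence $S$ over $G$ is a finite unordered list of elements of $G$ (element of the free abelian monoid $\mathcal F(G)$, operation $\cdot$); $|S|$ its length, $\mathsf v_g(S)$ the multiplicity of $g$, $\mathsf h(S)=\max_g\mathsf v_g(S)$, $\mathrm{supp}(S)$ the set of elements occurring, $T\mid S$ means subsequence, $T^{[-1]}\cdot S$ is $S$ with the terms of $T$ removed, $\sigma(T)$ the sum of terms, $\Sigma_n(S)=\{\sigma(T):T\mid S,|T|=n\}$. $\mathsf H(A)=\{g:g+A=A\}$. Sumsets $A_1+\dots+A_n=\{a_1+\dots+a_n:a_i\in A_i\}$. A setpartition is a sequence $\mathscr A=A_1\cdot\ldots\cdot A_n$ of finite nonempty subsets of $G$; $\mathsf S(\mathscr A)$ is the sequence of all elements of all $A_i$ (counted once per set containing it).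
   Formalization: "Items 1–4 are only possible if |Σ_n(S)|=m+1 or |supp(S)|=1" is stated as: one of Items 1–4 holds together with that condition, or Item 5 holds; read as an implication from Items 3, 4 it fails (S=0^5·1^5 over Z/2, n=5). *)

theory Defs
  imports Main "HOL-Library.Multiset" "HOL-Library.Numeral_Type" "HOL-Library.Product_Plus"
begin

(* Sequences over G are finite multisets 'a multiset (free abelian monoid F(G)). *)

definition hS :: "'a multiset \<Rightarrow> nat" where
  "hS S = Max (insert 0 ((\<lambda>g. count S g) ` set_mset S))"

definition SigmaN :: "nat \<Rightarrow> ('a::comm_monoid_add) multiset \<Rightarrow> 'a set" where
  "SigmaN n S = {sum_mset T | T. T \<subseteq># S \<and> size T = n}"

definition stab :: "('a::ab_group_add) set \<Rightarrow> 'a set" where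
  "stab A = {g. (\<lambda>a. g + a) ` A = A}"

definition is_subgroup :: "('a::ab_group_add) set \<Rightarrow> bool" where
  "is_subgroup K \<longleftrightarrow> 0 \<in> K \<and> (\<forall>a\<in>K. \<forall>b\<in>K. a + b \<in> K) \<and> (\<forall>a\<in>K. - a \<in> K)"

(* K is isomorphic to the abelian group of type 'b (e.g. 2 \<times> 2 = (Z/2Z)^2, or 3 = Z/3Z) *)
definition group_iso_onto :: "('b::ab_group_add \<Rightarrow> 'a::ab_group_add) \<Rightarrow> 'a set \<Rightarrow> bool" where
  "group_iso_onto f K \<longleftrightarrow> bij_betw f UNIV K \<and> (\<forall>a b. f (a + b) = f a + f b)"

(* sumset A_i, i \<in> I, for finitely many indices; {0} for I empty *)
definition sumset :: "(nat \<Rightarrow> ('a::comm_monoid_add) set) \<Rightarrow> nat set \<Rightarrow> 'a set" where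
  "sumset A I = {(\<Sum>i\<in>I. a i) | a. \<forall>i\<in>I. a i \<in> A i}"

definition setpartition :: "(nat \<Rightarrow> 'a set) \<Rightarrow> nat \<Rightarrow> bool" where
  "setpartition A n \<longleftrightarrow> (\<forall>i\<in>{1..n}. finite (A i) \<and> A i \<noteq> {})"

definition seqOf :: "(nat \<Rightarrow> 'a set) \<Rightarrow> nat \<Rightarrow> 'a multiset" where
  "seqOf A n = (\<Sum>i\<in>{1..n}. mset_set (A i))"

end

theory Submission
  imports Defs
begin

text \<open>
  Choose \<open>m\<close> disjoint pairs of distinct terms of \<open>S\<close>. Adding one more pair \<open>{a, b}\<close> to a sumset
  \<open>X\<close> enlarges it unless \<open>b - a\<close> stabilises \<open>X\<close>, so if no pair is redundant then the pairs already
  have \<open>m + 1\<close> sums, which must be all of \<open>\<Sigma>\<^sub>n(S)\<close>. Consider pairings with the largest sumset.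

  If one of them contains a redundant pair, choose it so that as many pairs as possible are split by
  the stabiliser \<open>K\<close> of its sumset. Exchanging elements between a redundant pair and another pair, or
  an unused term, can neither enlarge the sumset nor split more pairs. This forces every pair to
  meet, and every unused term to lie in, a single coset of \<open>K\<close>, which gives Item 5; the only
  obstruction is a coset of the Klein four-group (Item 1).

  Otherwise any two pairs have exactly three sums, so all differences are \<open>\<plusminus>d\<close> for a single \<open>d\<close>.
  Exchanges of elements show that any two pairs intersect and lead to Items 2, 3 and 4.
\<close>

section \<open>Sums over pairs\<close>

text \<open>The value of \<open>m\<close> is what makes the pairs available: \<open>m <= n\<close>
  and \<open>n + m <= |S|\<close> give \<open>2m <= |S|\<close>, and \<open>m + h(S) <= |S|\<close>
  keeps any one value from being too frequent to pair off. The stabiliser \<open>K\<close> depends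
  on the pairing, so counts of split pairs are comparable only if an exchange leaves
  \<open>K\<close> alone. An exchange that keeps all sums cannot gain any, by maximality, hence it
  keeps the sumset and \<open>K\<close>. The obstacle is a pair that is redundant only thanks to
  another redundant pair: exchanging these two may lose sums, so gains and losses have to be
  counted, and this count is where the Klein four-group survives. If no maximal pairing is
  redundant, an exchange may still drop to at most \<open>m\<close> sums. The blame then lies with
  the new pairs alone: a subgroup containing one old difference contains them all and has more than
  \<open>m\<close> elements. Two new pairs can be to blame only if they share a difference of order
  2.\<close>

definition psum :: "('a::ab_group_add \<times> 'a) multiset \<Rightarrow> 'a set" where
  "psum P = fold_mset (\<lambda>p X. (+) (fst p) ` X \<union> (+) (snd p) ` X) {0} P"

definition terms :: "('a \<times> 'a) multiset \<Rightarrow> 'a multiset" where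
  "terms P = image_mset fst P + image_mset snd P"

definition pair_diff :: "'a::ab_group_add \<times> 'a \<Rightarrow> 'a" where
  "pair_diff p = snd p - fst p"

text \<open>Dropping such a pair only translates the sumset, so the number of sums stays the same;
  this becomes the equality of cardinalities in Item 5.\<close>

definition redundant :: "('a::ab_group_add \<times> 'a) multiset \<Rightarrow> bool" where
  "redundant P \<longleftrightarrow> (\<exists>p\<in>#P. pair_diff p \<in> stab (psum (P - {#p#})))"

lemma pair_diff_Pair [simp]: "pair_diff (a, b) = b - a"
  by (simp add: pair_diff_def)

lemma terms_empty [simp]: "terms {#} = {#}"
  by (simp add: terms_def)

lemma terms_add_mset [simp]: "terms (add_mset p P) = add_mset (fst p) (add_mset (snd p) (terms P))"
  by (simp add: terms_def)

lemma size_terms [simp]: "size (terms P) = 2 * size P"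
  by (simp add: terms_def)

lemma psum_empty [simp]: "psum {#} = {0}"
  by (simp add: psum_def)

lemma psum_add_mset_image:
  "psum (add_mset p P) = (+) (fst p) ` psum P \<union> (+) (snd p) ` psum P"
proof -
  interpret comp_fun_commute "\<lambda>p X. (+) (fst p) ` X \<union> (+) (snd p :: 'a) ` X"
    by standard (auto simp: fun_eq_iff image_Un image_image add.left_commute)
  show ?thesis by (simp add: psum_def)
qed

lemma mem_image_plus: "x \<in> (+) a ` A \<longleftrightarrow> x - a \<in> (A :: 'a::ab_group_add set)"
  by (auto simp: image_iff) (metis add_diff_cancel_left' diff_add_cancel add.commute)

lemma mem_psum_add [simp]:
  "x \<in> psum (add_mset p P) \<longleftrightarrow> x - fst p \<in> psum P \<or> x - snd p \<in> psum P"
  by (simp add: psum_add_mset_image mem_image_plus)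

lemma finite_psum [simp]: "finite (psum P)"
  by (induction P) (auto simp: psum_add_mset_image)

lemma psum_nonempty [simp]: "psum P \<noteq> {}"
  by (induction P) (auto simp: psum_add_mset_image)

lemma card_plus [simp]: "card ((+) a ` A) = card (A :: 'a::ab_group_add set)"
  by (simp add: card_image)

section \<open>Stabilisers of finite sets\<close>

lemma stabI: "finite A \<Longrightarrow> (\<And>a. a \<in> A \<Longrightarrow> g + a \<in> A) \<Longrightarrow> g \<in> stab A"
  unfolding stab_def mem_Collect_eq
  by (rule card_subset_eq) (auto simp: card_image)

lemma stab_add: "g \<in> stab A \<Longrightarrow> a \<in> A \<Longrightarrow> g + a \<in> A"
  unfolding stab_def by blast

lemma stab_iff: "g \<in> stab A \<Longrightarrow> a - g \<in> A \<longleftrightarrow> a \<in> A"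
  unfolding stab_def mem_Collect_eq using mem_image_plus[of a g A] by simp

lemma stab_iff_add: "g \<in> stab A \<Longrightarrow> g + a \<in> A \<longleftrightarrow> a \<in> A"
  using stab_iff[of g A "g + a"] by simp

lemma zero_stab [simp]: "0 \<in> stab A"
  by (simp add: stab_def)

lemma stab_plus: "g \<in> stab A \<Longrightarrow> h \<in> stab A \<Longrightarrow> g + h \<in> stab A"
  unfolding stab_def mem_Collect_eq
  by (metis (no_types, lifting) add.assoc image_cong image_image)

lemma stab_uminus: "g \<in> stab A \<Longrightarrow> - g \<in> stab A"
  unfolding stab_def mem_Collect_eq
  by (metis (no_types, lifting) ab_left_minus add.assoc add_0 image_cong image_ident image_image)

lemma stab_uminus_iff: "- g \<in> stab A \<longleftrightarrow> g \<in> stab A"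
  using stab_uminus[of g A] stab_uminus[of "- g" A] by auto

lemma stab_diff: "g \<in> stab A \<Longrightarrow> h \<in> stab A \<Longrightarrow> g - h \<in> stab A"
  using stab_plus[of g A "- h"] stab_uminus[of h A] by simp

lemma stab_diff_commute: "g - h \<in> stab A \<longleftrightarrow> h - g \<in> stab A"
  using stab_uminus_iff[of "g - h" A] by simp

lemma is_subgroup_stab: "is_subgroup (stab A)"
  by (simp add: is_subgroup_def stab_plus stab_uminus)

lemma stab_image_plus [simp]: "stab ((+) c ` A) = stab A"
proof -
  have "(+) g ` (+) c ` A = (+) c ` (+) g ` A" for g
    unfolding image_image by (metis add.left_commute)
  then show ?thesis
    by (simp add: stab_def inj_image_eq_iff)
qed

lemma finite_stab:
  assumes "finite A" "A \<noteq> {}"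
  shows "finite (stab A)" "card (stab A) \<le> card A"
proof -
  obtain a where a: "a \<in> A" using assms by blast
  have sub: "(\<lambda>g. g + a) ` stab A \<subseteq> A" using a stab_add by blast
  have inj: "inj_on (\<lambda>g. g + a) (stab A)" by (simp add: inj_on_def)
  show "finite (stab A)" using finite_subset[OF sub assms(1)] inj by (rule finite_imageD)
  show "card (stab A) \<le> card A" using card_inj_on_le[OF inj sub assms(1)] .
qed

section \<open>Growth of the sumset as pairs are added\<close>

lemma stab_psum_add: "stab (psum P) \<subseteq> stab (psum (add_mset p P))"
proof
  fix g assume g: "g \<in> stab (psum P)"
  show "g \<in> stab (psum (add_mset p P))"
    by (rule stabI) (use stab_iff_add[OF g] in \<open>auto simp: add_diff_eq[symmetric]\<close>)
qed

lemma stab_psum_mono: "Q \<subseteq># P \<Longrightarrow> stab (psum Q) \<subseteq> stab (psum P)"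
proof -
  have "stab (psum Q) \<subseteq> stab (psum (Q + R))" for R
    proof (induction R)
    case (add r R)
    then show ?case using stab_psum_add[of "Q + R" r] by auto
  qed simp
  then show "Q \<subseteq># P \<Longrightarrow> stab (psum Q) \<subseteq> stab (psum P)"
    by (metis subset_mset.add_diff_inverse)
qed

lemma psum_add_stab:
  assumes "pair_diff p \<in> stab (psum P)"
  shows "psum (add_mset p P) = (+) (fst p) ` psum P"
proof -
  have "x - snd p \<in> psum P \<longleftrightarrow> x - fst p \<in> psum P" for x
    using stab_iff[OF assms, of "x - fst p"] by (simp add: pair_diff_def)
  then show ?thesis by (auto simp: mem_image_plus)
qed

text \<open>If nothing is gained, each of the two translates of \<open>psum P\<close> already fills
  the union, so the translates coincide and the difference of the pair is a period.\<close>

lemma card_psum_add_less: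
  assumes "pair_diff p \<notin> stab (psum P)"
  shows "card (psum P) < card (psum (add_mset p P))"
proof (rule ccontr)
  assume "\<not> ?thesis"
  then have le: "card (psum (add_mset p P)) \<le> card (psum P)" by simp
  have 1: "(+) (fst p) ` psum P = psum (add_mset p P)"
    by (rule card_seteq) (use le in \<open>auto simp: mem_image_plus\<close>)
  have 2: "(+) (snd p) ` psum P = psum (add_mset p P)"
    by (rule card_seteq) (use le in \<open>auto simp: mem_image_plus\<close>)
  have "pair_diff p \<in> stab (psum P)"
  proof (rule stabI)
    fix a assume "a \<in> psum P"
    then have "a + snd p \<in> (+) (snd p) ` psum P" by (simp add: mem_image_plus)
    then have "a + snd p \<in> (+) (fst p) ` psum P" by (simp only: 1 2)
    then show "pair_diff p + a \<in> psum P" unfolding mem_image_plus by (simp add: pair_diff_def algebra_simps)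
  qed simp
  with assms show False ..
qed

lemma card_psum_add_le: "card (psum P) \<le> card (psum (add_mset p P))"
  by (cases "pair_diff p \<in> stab (psum P)") (auto simp: psum_add_stab dest: card_psum_add_less)

lemma card_psum_mono: "Q \<subseteq># P \<Longrightarrow> card (psum Q) \<le> card (psum P)"
proof -
  have "card (psum Q) \<le> card (psum (Q + R))" for R
    proof (induction R)
    case (add r R)
    then show ?case using card_psum_add_le[of "Q + R" r] by simp
  qed simp
  then show "Q \<subseteq># P \<Longrightarrow> card (psum Q) \<le> card (psum P)"
    by (metis subset_mset.add_diff_inverse)
qed

lemma not_redundant_add:
  "\<not> redundant (add_mset p P) \<Longrightarrow> pair_diff p \<notin> stab (psum P)"
  by (auto simp: redundant_def)

text \<open>Stabilisers only grow as pairs are added, so a redundant pair stays redundant.\<close>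

lemma redundant_add: "redundant P \<Longrightarrow> redundant (add_mset p P)"
proof -
  assume "redundant P"
  then obtain q where q: "q \<in># P" "pair_diff q \<in> stab (psum (P - {#q#}))"
    by (auto simp: redundant_def)
  have "P - {#q#} \<subseteq># add_mset p P - {#q#}"
    by (simp add: subseteq_mset_def)
  then have "pair_diff q \<in> stab (psum (add_mset p P - {#q#}))" using q(2) stab_psum_mono by blast
  then show ?thesis using q(1) unfolding redundant_def by auto
qed

lemma redundant_mono: "Q \<subseteq># P \<Longrightarrow> redundant Q \<Longrightarrow> redundant P"
proof -
  have "redundant Q \<Longrightarrow> redundant (Q + R)" for R
    proof (induction R)
    case (add r R)
    then show ?case using redundant_add[of "Q + R" r] by auto
  qed simp
  then show "Q \<subseteq># P \<Longrightarrow> redundant Q \<Longrightarrow> redundant P"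
    by (metis subset_mset.add_diff_inverse)
qed

text \<open>Each pair outside \<open>Q\<close> gains at least one sum. Starting from a general
  \<open>Q\<close> turns an upper bound for \<open>P\<close> into one for its subfamilies.\<close>

lemma card_psum_not_redundant:
  assumes "\<not> redundant P" "Q \<subseteq># P"
  shows "card (psum Q) + (size P - size Q) \<le> card (psum P)"
proof -
  have "\<not> redundant (Q + R) \<Longrightarrow> card (psum Q) + size R \<le> card (psum (Q + R))" for R
  proof (induction R)
    case (add r R)
    then have "\<not> redundant (Q + R)" "pair_diff r \<notin> stab (psum (Q + R))"
      using redundant_add[of "Q + R" r] not_redundant_add[of r "Q + R"] by auto
    then show ?case using add.IH card_psum_add_less[of r "Q + R"] by simp
  qed simp
  from this[of "P - Q"] assms show ?thesis by (simp add: size_Diff_submset)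
qed

lemma card_psum_not_redundant_ge: "\<not> redundant P \<Longrightarrow> size P + 1 \<le> card (psum P)"
  using card_psum_not_redundant[of P "{#}"] by simp

lemma psum_in_coset:
  assumes "is_subgroup N" "\<And>p. p \<in># P \<Longrightarrow> pair_diff p \<in> N"
  shows "\<exists>c. \<forall>x\<in>psum P. x - c \<in> N"
  using assms(2)
proof (induction P)
  case empty
  then show ?case using assms(1) by (auto simp: is_subgroup_def intro!: exI[of _ 0])
next
  case (add p P)
  then obtain c where c: "\<forall>x\<in>psum P. x - c \<in> N" by auto
  have d: "pair_diff p \<in> N" using add.prems by simp
  have "x - (fst p + c) \<in> N" if "x \<in> psum (add_mset p P)" for x
  proof -
    from that consider "x - fst p \<in> psum P" | "x - snd p \<in> psum P" by auto
    then show ?thesis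
    proof cases
      case 1
      then show ?thesis using c by (simp add: diff_diff_eq[symmetric])
    next
      case 2
      then have "(x - snd p - c) + pair_diff p \<in> N" using c d assms(1) unfolding is_subgroup_def by blast
      then show ?thesis by (simp add: pair_diff_def algebra_simps)
    qed
  qed
  then show ?case by blast
qed

lemma card_psum_le_subgroup:
  assumes "is_subgroup N" "finite N" "\<And>p. p \<in># P \<Longrightarrow> pair_diff p \<in> N"
  shows "card (psum P) \<le> card N"
proof -
  obtain c where c: "\<forall>x\<in>psum P. x - c \<in> N" using psum_in_coset[OF assms(1,3)] by blast
  then have "psum P \<subseteq> (+) c ` N" by (auto simp: mem_image_plus)
  from card_mono[OF _ this] assms(2) show ?thesis by simp
qed

text \<open>In a minimal subfamily with at most as many sums as pairs, every pair is redundant.\<close>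

lemma violating_subgroup:
  assumes "card (psum P) \<le> size P"
  shows "\<exists>Q. Q \<subseteq># P \<and> Q \<noteq> {#} \<and> (\<forall>p\<in>#Q. pair_diff p \<in> stab (psum Q)) \<and> card (stab (psum Q)) = size Q"
proof -
  define bad where "bad Q \<longleftrightarrow> Q \<subseteq># P \<and> card (psum Q) \<le> size Q" for Q
  have "bad P" using assms by (simp add: bad_def)
  then obtain Q where Q: "bad Q" and min: "\<And>R. size R < size Q \<Longrightarrow> \<not> bad R"
    using ex_has_least_nat[of bad P size] leD by blast
  have ne: "Q \<noteq> {#}" using Q by (auto simp: bad_def)
  have *: "pair_diff p \<in> stab (psum Q) \<and> card (psum Q) = size Q" if pQ: "p \<in># Q" for p
  proof -
    obtain R where R: "Q = add_mset p R" using multi_member_split[OF pQ] by blast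
    have "R \<subseteq># P" using Q R unfolding bad_def by (meson mset_subset_eq_insertD subset_mset.less_imp_le)
    \<comment> \<open>By minimality \<open>R\<close> has more sums than pairs, while
      \<open>Q\<close> has one pair more and at most \<open>size Q\<close> sums; so adding
      \<open>p\<close> gains nothing.\<close>
    then have "size R < card (psum R)" using min[of R] R by (auto simp: bad_def)
    then have "card (psum Q) \<le> card (psum R)" "size Q \<le> card (psum R)"
      using Q R by (auto simp: bad_def)
    then have "pair_diff p \<in> stab (psum R)" using card_psum_add_less[of p R] R by auto
    then show ?thesis
      using stab_psum_add[of R p] R \<open>size Q \<le> card (psum R)\<close> card_psum_add_le[of R p] Q
      by (auto simp: bad_def)
  qed
  \<comment> \<open>All differences are periods of \<open>psum Q\<close>, so \<open>psum Q\<close>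
    lies in a single coset of its own stabiliser and therefore fills it.\<close>
  have "card (psum Q) \<le> card (stab (psum Q))"
    by (rule card_psum_le_subgroup) (use * in \<open>auto simp: is_subgroup_stab finite_stab\<close>)
  moreover have "card (stab (psum Q)) \<le> card (psum Q)" by (rule finite_stab) auto
  ultimately have "card (stab (psum Q)) = size Q" using * ne by force
  then show ?thesis using Q ne * by (auto simp: bad_def)
qed

text \<open>The translate of \<open>psum P\<close> by \<open>fst p\<close> misses at most one point
  of the new sumset, and the difference of \<open>p\<close> shifts that translate into the new
  sumset. A nonzero period \<open>k\<close> moves the missing point into the translate, so the shift
  works for that point too.\<close>

lemma pair_diff_stab_of_card_Suc:
  assumes "stab (psum (add_mset p P)) \<noteq> {0}"
    and "card (psum (add_mset p P)) \<le> card (psum P) + 1"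
  shows "pair_diff p \<in> stab (psum (add_mset p P))"
proof -
  let ?C = "psum (add_mset p P)"
  let ?B = "(+) (fst p) ` psum P"
  obtain k where k: "k \<in> stab ?C" "k \<noteq> 0" using assms(1) zero_stab by blast
  have B: "?B \<subseteq> ?C" by (auto simp: mem_image_plus)
  have "card (?C - ?B) = card ?C - card ?B" using B by (intro card_Diff_subset) auto
  then have one: "card (?C - ?B) \<le> 1" using assms(2) by simp
  have shift: "pair_diff p + c \<in> ?C" if "c \<in> ?B" for c
    using that by (auto simp: pair_diff_def mem_image_plus)
  show ?thesis
  proof (rule stabI)
    fix c assume c: "c \<in> ?C"
    show "pair_diff p + c \<in> ?C"
    proof (cases "c \<in> ?B")
      case False
      have kc: "k + c \<in> ?C" using k(1) c by (rule stab_add)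
      have "k + c \<in> ?B"
      proof (rule ccontr)
        assume "k + c \<notin> ?B"
        then have "{c, k + c} \<subseteq> ?C - ?B" using c kc False by (simp only: insert_subset Diff_iff empty_subsetI simp_thms)
        from card_mono[OF _ this] one k(2) show False by simp
      qed
      from shift[OF this] have "k + (pair_diff p + c) \<in> ?C" by (metis add.left_commute)
      then show ?thesis using stab_iff_add[OF k(1)] by blast
    qed (rule shift)
  qed simp
qed

text \<open>Without redundancy the pairs other than \<open>p\<close> would have at least
  \<open>size P\<close> sums, so \<open>p\<close> would gain at most one, and periodicity would make
  its difference a period. The lemma certifies that a pairing obtained by an exchange is still
  redundant.\<close>

lemma redundant_of_nonstab:
  assumes "stab (psum P) \<noteq> {0}" "card (psum P) \<le> size P + 1" "p \<in># P" "pair_diff p \<notin> stab (psum P)"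
  shows "redundant P"
proof (rule ccontr)
  assume nr: "\<not> redundant P"
  obtain Q where Q: "P = add_mset p Q" using multi_member_split[OF assms(3)] by blast
  have "card (psum Q) \<ge> size P"
    using card_psum_not_redundant_ge[of Q] nr redundant_add[of Q p] Q by auto
  then have "pair_diff p \<in> stab (psum P)" using pair_diff_stab_of_card_Suc[of p Q] assms(1,2) Q by auto
  with assms(4) show False ..
qed

section \<open>Redundant pairings\<close>

text \<open>Since \<open>terms\<close> counts multiplicities, the submultiset condition expresses
  that the pairs are disjoint as subsequences of \<open>S\<close>, even when values repeat.\<close>

definition pairing :: "'a multiset \<Rightarrow> nat \<Rightarrow> ('a \<times> 'a) multiset \<Rightarrow> bool" where
  "pairing S m P \<longleftrightarrow> terms P \<subseteq># S \<and> size P = m \<and> (\<forall>p\<in>#P. fst p \<noteq> snd p)"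

definition num_outside :: "('a::ab_group_add \<times> 'a) multiset \<Rightarrow> nat" where
  "num_outside P = size {#p \<in># P. pair_diff p \<notin> stab (psum P)#}"

lemma add_mset_subset_of_diff:
  "M \<subseteq># S \<Longrightarrow> c \<in># S - M \<Longrightarrow> add_mset c M \<subseteq># S"
  by (auto simp: subseteq_mset_def in_diff_count Suc_le_eq)

text \<open>The last assumption holds because \<open>m + 1\<close> sums already exhaust \<open>\<Sigma>\<^sub>n(S)\<close>.\<close>

locale extremal_pairing =
  fixes S :: "'a::ab_group_add multiset" and m :: nat and P :: "('a \<times> 'a) multiset"
  assumes pairing: "pairing S m P"
    and max: "pairing S m P' \<Longrightarrow> card (psum P') \<le> card (psum P)"
    and le: "card (psum P) \<le> m + 1"
    and red: "redundant P"
    and num_outside_max: "pairing S m P' \<Longrightarrow> card (psum P') = card (psum P) \<Longrightarrow> redundant P' \<Longrightarrow>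
      num_outside P' \<le> num_outside P"
    and full: "card (psum P) = m + 1 \<Longrightarrow> terms P' = terms P \<Longrightarrow> psum P' \<subseteq> psum P"
begin

abbreviation K where "K \<equiv> stab (psum P)"

lemma size_P: "size P = m" and terms_P: "terms P \<subseteq># S" and diff_nz: "p \<in># P \<Longrightarrow> pair_diff p \<noteq> 0"
  using pairing by (auto simp: pairing_def pair_diff_def)

text \<open>As \<open>psum P\<close> is a translate of \<open>psum B\<close>, both have stabiliser
  \<open>K\<close>. If \<open>c\<close> lay outside the coset, the pair of \<open>fst j\<close> and
  \<open>c\<close> would enlarge \<open>psum B\<close>, and the new pairing would beat the
  maximum.\<close>

lemma rest_in_coset:
  assumes P: "P = add_mset j B" and j: "pair_diff j \<in> stab (psum B)" and c: "c \<in># S - terms P"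
  shows "c - fst j \<in> K"
proof (rule ccontr)
  assume nK: "c - fst j \<notin> K"
  let ?P = "add_mset (fst j, c) B"
  have Bc: "psum P = (+) (fst j) ` psum B" using psum_add_stab[OF j] P by simp
  have ne: "fst j \<noteq> c" using nK by auto
  have "add_mset c (terms P) \<subseteq># S" by (rule add_mset_subset_of_diff[OF terms_P c])
  moreover have "terms ?P \<subseteq># add_mset c (terms P)"
    by (simp add: P add_mset_commute[of c])
  ultimately have "terms ?P \<subseteq># S" by (rule subset_mset.order_trans[rotated])
  then have "pairing S m ?P" using pairing ne by (auto simp: pairing_def P)
  then have "card (psum ?P) \<le> card (psum B)" using max Bc by fastforce
  moreover have "pair_diff (fst j, c) \<notin> stab (psum B)" using nK by (simp add: Bc)
  ultimately show False using card_psum_add_less by fastforce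
qed

lemma pair_meets_coset:
  assumes P: "P = add_mset i (add_mset j B)" and j: "pair_diff j \<in> stab (psum B)"
  shows "fst i - fst j \<in> K \<or> snd i - fst j \<in> K"
proof (rule ccontr)
  assume nm: "\<not> (fst i - fst j \<in> K \<or> snd i - fst j \<in> K)"
  obtain a b z z' where i: "i = (a, b)" and jz: "j = (z, z')" by (metis surj_pair)
  have nK: "a - z \<notin> K" "b - z \<notin> K" using nm i jz by auto
  have jK: "z' - z \<in> K"
    using j stab_psum_mono[of B P] P jz by (auto simp: subset_mset.add_increasing)
  have nK': "z - a \<notin> K" "z' - b \<notin> K"
  proof -
    show "z - a \<notin> K" using nK(1) stab_diff_commute by blast
    show "z' - b \<notin> K"
    proof
      assume "z' - b \<in> K"
      from stab_diff[OF jK this] show False using nK(2) by simp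
    qed
  qed
  \<comment> \<open>Exchanging \<open>b\<close> and \<open>z\<close> keeps all sums, since \<open>z' - z\<close> stabilises the sums of \<open>B\<close>, but splits
    more pairs modulo \<open>K\<close>.\<close>
  let ?P = "add_mset (a, z) (add_mset (b, z') B)"
  have ne: "a \<noteq> z" "b \<noteq> z'" using nK' by auto
  have terms: "terms ?P = terms P" by (simp add: P i jz)
  have pairing': "pairing S m ?P" using pairing ne unfolding pairing_def terms by (auto simp: P)
  have sub: "psum P \<subseteq> psum ?P"
  proof
    fix x assume "x \<in> psum P"
    then have "x - a - z \<in> psum B \<or> x - a - z' \<in> psum B \<or> x - b - z \<in> psum B \<or> x - b - z' \<in> psum B"
      by (auto simp: P i jz)
    moreover have "y - z' \<in> psum B \<longleftrightarrow> y - z \<in> psum B" for y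
      using stab_iff[OF j, of "y - z"] by (simp add: jz)
    moreover have "x - b - z = x - z - b" by (simp add: algebra_simps)
    ultimately have "x - a - z' \<in> psum B \<or> x - z - b \<in> psum B" by simp
    then show "x \<in> psum ?P" by auto
  qed
  then have eq: "psum ?P = psum P"
    using max[OF pairing'] by (metis card_seteq finite_psum)
  \<comment> \<open>Before the exchange only \<open>i\<close> can be split among the two pairs;
    afterwards both are.\<close>
  have "size {#p \<in># P. pair_diff p \<notin> K#} < size {#p \<in># ?P. pair_diff p \<notin> K#}"
    using nK' jK by (simp add: P i jz)
  then have "num_outside P < num_outside ?P" by (simp add: num_outside_def eq)
  moreover have "redundant ?P"
  proof (rule redundant_of_nonstab)
    show "stab (psum ?P) \<noteq> {0}"
      using jK diff_nz[of j] unfolding eq by (auto simp: P jz)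
    show "card (psum ?P) \<le> size ?P + 1" using le size_P unfolding eq by (simp add: P)
    show "(a, z) \<in># ?P" by simp
    show "pair_diff (a, z) \<notin> stab (psum ?P)" using nK'(1) unfolding eq by simp
  qed
  ultimately show False using num_outside_max[OF pairing'] eq by auto
qed

text \<open>Modulo \<open>K\<close> every sum of \<open>P\<close> has the form
  \<open>fst i + fst j + b\<close> with \<open>b\<close> a sum of \<open>B\<close>. Pairing first
  with first and second with second entries also allows \<open>fst j + snd j + b\<close>, which is
  \<open>2 fst j + b\<close> modulo \<open>K\<close>. When the sums are exhausted this is again a
  sum of \<open>P\<close>, so \<open>fst j - fst i\<close> is a period.\<close>

lemma same_coset_of_full:
  assumes P: "P = add_mset i (add_mset j B)" and i: "pair_diff i \<in> K" and j: "pair_diff j \<in> K"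
    and card: "card (psum P) = m + 1"
  shows "fst i - fst j \<in> K"
proof -
  let ?P = "add_mset (fst i, fst j) (add_mset (snd i, snd j) B)"
  have sub: "psum ?P \<subseteq> psum P" using card by (rule full) (simp add: P)
  have "fst j - fst i \<in> K"
  proof (rule stabI)
    fix c assume "c \<in> psum P"
    then obtain k where k: "k \<in> K" "c - fst i - fst j - k \<in> psum B"
    proof -
      assume *: "\<And>k. k \<in> K \<Longrightarrow> c - fst i - fst j - k \<in> psum B \<Longrightarrow> thesis"
      from \<open>c \<in> psum P\<close>
      have "c - fst i - fst j \<in> psum B \<or> c - fst i - snd j \<in> psum B
        \<or> c - snd i - fst j \<in> psum B \<or> c - snd i - snd j \<in> psum B"
        by (auto simp: P)
      then show thesis
        using *[of 0] *[of "pair_diff i"] *[of "pair_diff j"] *[of "pair_diff i + pair_diff j"] i j stab_plus[OF i j]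
        by (auto simp: pair_diff_def algebra_simps)
    qed
    have "c - fst i - fst j - k + fst j + snd j \<in> psum ?P" using k(2) by (simp add: algebra_simps)
    then have *: "c - fst i - fst j - k + fst j + snd j \<in> psum P" using sub by blast
    have "(k - pair_diff j) + (c - fst i - fst j - k + fst j + snd j) \<in> psum P"
      using stab_diff[OF k(1) j] * by (rule stab_add)
    then show "fst j - fst i + c \<in> psum P" by (simp add: pair_diff_def algebra_simps)
  qed simp
  then show ?thesis using stab_diff_commute by blast
qed

section \<open>Two redundant pairs in different cosets\<close>

definition klein :: "'a \<Rightarrow> 'a \<Rightarrow> 'a \<Rightarrow> bool" where
  "klein a g y \<longleftrightarrow> m = 2 \<and> S = {#a, a + g, a + y, a + y + g#} \<and> g \<noteq> 0 \<and> y \<noteq> 0 \<and> y \<noteq> g \<and>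
     g + g = 0 \<and> y + y = 0"

text \<open>If one pair were redundant without the other, \<open>pair_meets_coset\<close> would put
  them in one coset. So each is redundant only thanks to the other; the counts are then rigid, with
  \<open>m - 1\<close> sums for \<open>B\<close> and \<open>m\<close> sums once one or both pairs
  are added. Comparison with the exchanged pairing forces \<open>K\<close> to have order 2 and
  \<open>B\<close> to be empty.\<close>

lemma klein_of_two_cosets:
  assumes P: "P = add_mset j1 (add_mset j2 B)"
    and j1: "pair_diff j1 \<in> stab (psum (add_mset j2 B))" and j2: "pair_diff j2 \<in> stab (psum (add_mset j1 B))"
    and nK: "fst j1 - fst j2 \<notin> K"
  shows "\<exists>a g y. klein a g y"
proof -
  have P': "P = add_mset j2 (add_mset j1 B)" by (simp add: P add_mset_commute)
  have j1K: "pair_diff j1 \<in> K" using j1 stab_psum_add[of "add_mset j2 B" j1] P by auto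
  have j2K: "pair_diff j2 \<in> K" using j2 stab_psum_add[of "add_mset j1 B" j2] P' by auto
  have nz: "pair_diff j1 \<noteq> 0" "pair_diff j2 \<noteq> 0" using diff_nz by (auto simp: P)
  obtain a b z z' where ab: "j1 = (a, b)" and zz: "j2 = (z, z')" by (metis surj_pair)
  have naz: "a - z \<notin> K" "z - a \<notin> K" using nK stab_diff_commute by (auto simp: ab zz)
  have shift: "u - w \<in> K \<longleftrightarrow> v - w \<in> K" if "u - v \<in> K" for u v w
  proof
    assume "u - w \<in> K" from stab_diff[OF this that] show "v - w \<in> K" by simp
  next
    assume "v - w \<in> K" from stab_plus[OF that this] show "u - w \<in> K" by simp
  qed
  have nE1: "pair_diff j1 \<notin> stab (psum B)"
  proof
    assume "pair_diff j1 \<in> stab (psum B)"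
    from pair_meets_coset[OF P' this] show False
      using shift[of z' z a] j2K naz by (auto simp: ab zz)
  qed
  have nE2: "pair_diff j2 \<notin> stab (psum B)"
  proof
    assume "pair_diff j2 \<in> stab (psum B)"
    from pair_meets_coset[OF P this] show False
      using shift[of b a z] j1K naz by (auto simp: ab zz)
  qed
  \<comment> \<open>A pair redundant in \<open>B\<close> stays redundant when only \<open>j1\<close>
    or only \<open>j2\<close> is added, so both would meet its coset and hence share it.\<close>
  have nrB: "\<not> redundant B"
  proof
    assume "redundant B"
    then obtain j3 B' where B: "B = add_mset j3 B'" and j3: "pair_diff j3 \<in> stab (psum B')"
      unfolding redundant_def by (metis insert_DiffM)
    have 1: "pair_diff j3 \<in> stab (psum (add_mset j2 B'))" "pair_diff j3 \<in> stab (psum (add_mset j1 B'))"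
      using j3 stab_psum_add by blast+
    have "fst j1 - fst j3 \<in> K \<or> snd j1 - fst j3 \<in> K"
      by (rule pair_meets_coset[OF _ 1(1)]) (simp add: P B add_mset_commute)
    then have A: "a - fst j3 \<in> K" using shift[of b a] j1K by (auto simp: ab)
    have "fst j2 - fst j3 \<in> K \<or> snd j2 - fst j3 \<in> K"
      by (rule pair_meets_coset[OF _ 1(2)]) (simp add: P B add_mset_commute)
    then have "z - fst j3 \<in> K" using shift[of z' z] j2K by (auto simp: zz)
    from stab_diff[OF A this] show False using naz by simp
  qed
  let ?C = "psum (add_mset j2 B)"
  have Ceq: "psum P = (+) a ` ?C" using psum_add_stab[OF j1] by (simp add: P ab)
  have Keq: "K = stab ?C" by (simp add: Ceq)
  have cardC: "card ?C = card (psum P)" by (simp add: Ceq)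
  have szB: "size B + 2 = m" using size_P by (simp add: P)
  have "card (psum P) \<noteq> m + 1" using same_coset_of_full[OF P j1K j2K] nK by blast
  then have cle: "card ?C \<le> m" using le cardC by simp
  have "size B + 1 \<le> card (psum B)" by (rule card_psum_not_redundant_ge[OF nrB])
  moreover have "card (psum B) < card ?C" by (rule card_psum_add_less[OF nE2])
  ultimately have cardE: "card (psum B) = m - 1" and cardm: "card ?C = m"
    using cle szB by auto
  let ?P = "add_mset (a, z) (add_mset (b, z') B)"
  have bz: "b \<noteq> z'"
  proof
    assume "b = z'"
    then show False using shift[of b a z'] shift[of z' z a] j1K j2K naz stab_diff_commute[of z' a]
      by (auto simp: ab zz)
  qed
  have "a \<noteq> z" using naz by auto
  then have "pairing S m ?P" using pairing bz unfolding pairing_def by (auto simp: P ab zz add_mset_commute)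
  then have cP: "card (psum ?P) \<le> m" using max cardC cardm by fastforce
  let ?E = "(+) z ` psum B"
  have EC: "?E \<subseteq> ?C" by (auto simp: mem_image_plus zz)
  have "card (?C - ?E) = 1"
    using EC szB by (subst card_Diff_subset) (auto simp: cardE cardm)
  then obtain q where q: "?C - ?E = {q}" by (auto simp: card_1_singleton_iff)
  have finK: "finite K" by (rule finite_stab) auto
  \<comment> \<open>The sums of \<open>B\<close> miss a single element of a translate of the \<open>K\<close>-periodic set \<open>?C\<close>, so the
    exchanged pairing gains at least \<open>card K - 1\<close> sums and loses at most one.\<close>
  have K2: "card K \<le> 2"
  proof -
    let ?y = "z - a"
    obtain w where w: "w \<in> ?C" "w - ?y \<notin> ?C"
    proof -
      have "a - z \<notin> stab ?C" using naz Keq by blast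
      then have "\<exists>w\<in>?C. (a - z) + w \<notin> ?C" using stabI[of ?C "a - z"] finite_psum by blast
      then show thesis using that by (auto simp: algebra_simps)
    qed
    let ?W = "(\<lambda>k. k + w - ?y) ` {k \<in> K. k + w \<noteq> q}"
    have inj: "inj_on (\<lambda>k. k + w - ?y) {k \<in> K. k + w \<noteq> q}" by (simp add: inj_on_def)
    have disj: "?W \<inter> ?E = {}"
    proof -
      have "k + w - ?y \<notin> ?C" if "k \<in> K" for k
        using stab_iff_add[of k ?C "w - ?y"] that w Keq by (simp add: add_diff_eq)
      then show ?thesis using EC by blast
    qed
    \<comment> \<open>The points of \<open>?E\<close> use the choices \<open>z\<close> and
      \<open>z'\<close>, those of \<open>?W\<close> the choices \<open>a\<close> and
      \<open>z'\<close>: a point \<open>k + w\<close> other than \<open>q\<close> lies in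
      \<open>z + psum B\<close>, and subtracting \<open>z - a\<close> moves it into
      \<open>a + psum B\<close>.\<close>
    have sub: "(+) z' ` (?W \<union> ?E) \<subseteq> psum ?P"
    proof -
      have "z' + u \<in> psum ?P" if "u \<in> ?E" for u
        using that by (auto simp: mem_image_plus algebra_simps)
      moreover have "z' + u \<in> psum ?P" if uW: "u \<in> ?W" for u
      proof -
        obtain k where k: "k \<in> K" "k + w \<noteq> q" "u = k + w - ?y" using uW by auto
        have "k + w \<in> ?C" using k w Keq stab_add by blast
        then have "k + w \<in> ?E" using k q by blast
        then show ?thesis by (auto simp: mem_image_plus k algebra_simps)
      qed
      ultimately show ?thesis by blast
    qed
    have "card (?W \<union> ?E) = card ?W + card ?E"
      using disj finK by (intro card_Un_disjoint) auto
    then have "card ?W + card ?E = card ((+) z' ` (?W \<union> ?E))" by (simp only: card_plus)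
    also have "\<dots> \<le> card (psum ?P)" by (rule card_mono[OF finite_psum sub])
    also have "\<dots> \<le> m" by (rule cP)
    finally have "card ?W + card ?E \<le> m" .
    then have "card ?W \<le> 1" using szB by (simp add: cardE)
    then have "card {k \<in> K. k + w \<noteq> q} \<le> 1" by (simp only: card_image[OF inj])
    moreover have "K \<subseteq> insert (q - w) {k \<in> K. k + w \<noteq> q}" by auto
    then have "card K \<le> card (insert (q - w) {k \<in> K. k + w \<noteq> q})"
      using finK by (intro card_mono) auto
    moreover have "\<dots> \<le> Suc (card {k \<in> K. k + w \<noteq> q})"
      using finK by (simp add: card_insert_if)
    ultimately show ?thesis by linarith
  qed
  have Kg: "k = pair_diff j1" if "k \<in> K" "k \<noteq> 0" for k
  proof (rule ccontr)
    assume "k \<noteq> pair_diff j1"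
    then have "card {0, k, pair_diff j1} = 3" using that nz by simp
    moreover have "card {0, k, pair_diff j1} \<le> card K" using that j1K finK by (intro card_mono) auto
    ultimately show False using K2 by simp
  qed
  define g where "g = pair_diff j1"
  have g: "g \<noteq> 0" "pair_diff j1 = g" "pair_diff j2 = g" "g \<in> K"
    using nz j1K Kg[OF j2K nz(2)] by (simp_all add: g_def)
  have gg: "g + g = 0"
  proof (rule ccontr)
    assume "g + g \<noteq> 0"
    then have "g + g = g" using Kg[OF stab_plus[OF g(4) g(4)]] g(2) by simp
    then show False using g by simp
  qed
  \<comment> \<open>Suppose \<open>p\<close> is a pair of \<open>B\<close>. If it is not split, it
    is invariant under the involution \<open>g\<close>, so \<open>g\<close> stabilises
    \<open>psum B\<close>, against \<open>nE1\<close>. If it is split, deleting it from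
    \<open>P\<close> costs at least two sums, which leaves so few that \<open>j1\<close> gains
    nothing over \<open>B'\<close>, again against \<open>nE1\<close>.\<close>
  have "B = {#}"
  proof (rule ccontr)
    assume "B \<noteq> {#}"
    then obtain p B' where B: "B = add_mset p B'" by (cases B) auto
    show False
    proof (cases "pair_diff p \<in> K")
      case True
      have "p \<in># P" by (simp add: P B)
      then have "pair_diff p = g" using Kg[OF True diff_nz] g(2) by simp
      then have p: "snd p = fst p + g" by (simp add: pair_diff_def algebra_simps)
      have "g \<in> stab (psum B)"
      proof (rule stabI)
        fix x assume "x \<in> psum B"
        then have "x - fst p \<in> psum B' \<or> x - snd p \<in> psum B'" by (simp add: B)
        moreover have "g + x - snd p = x - fst p" by (simp add: p)
        moreover have "g + x - fst p = x - snd p"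
          using gg by (simp add: p algebra_simps eq_neg_iff_add_eq_0)
        ultimately show "g + x \<in> psum B" unfolding B mem_psum_add by metis
      qed simp
      then show False using nE1 g by simp
    next
      case False
      let ?Q = "add_mset j1 (add_mset j2 B')"
      have PQ: "P = add_mset p ?Q" by (simp add: P B add_mset_commute)
      have "K \<noteq> {0}" using g by auto
      then have "card (psum P) > card (psum ?Q) + 1"
        using pair_diff_stab_of_card_Suc[of p ?Q] False PQ by force
      then have "card (psum ?Q) + 2 \<le> m" using cardC cardm by simp
      moreover have "m \<le> card (psum B') + 2"
        using card_psum_not_redundant_ge[of B'] nrB redundant_add[of B' p] szB B by auto
      moreover have "card (psum (add_mset j1 B')) \<le> card (psum ?Q)"
        by (rule card_psum_mono) (simp add: add_mset_commute[of j1])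
      ultimately have "card (psum (add_mset j1 B')) \<le> card (psum B')" by simp
      then have "pair_diff j1 \<in> stab (psum B')" using card_psum_add_less[of j1 B'] by force
      then show False using nE1 stab_psum_add B by blast
    qed
  qed
  then have m2: "m = 2" using szB by simp
  have b: "b = a + g" and z': "z' = z + g" using g by (auto simp: ab zz algebra_simps)
  define y where "y = z - a"
  have z: "z = a + y" by (simp add: y_def)
  have yK: "y \<notin> K" using naz by (simp add: y_def)
  have yy: "y + y = 0"
  proof (rule ccontr)
    assume yy: "y + y \<noteq> 0"
    \<comment> \<open>With \<open>B\<close> empty the exchanged pairing has at most two sums, and
      among these three only \<open>a + b\<close> and \<open>z + z'\<close> can coincide, which
      requires \<open>y + y = 0\<close>.\<close>
    have "{a + z', a + b, z + z'} \<subseteq> psum ?P" using \<open>B = {#}\<close> by auto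
    then have "card {a + z', a + b, z + z'} \<le> card (psum ?P)" by (rule card_mono[OF finite_psum])
    then have "card {a + z', a + b, z + z'} \<le> 2" using cP m2 by linarith
    moreover have "a + z' \<noteq> a + b" "a + z' \<noteq> z + z'" "a + b \<noteq> z + z'"
      using yK yy by (auto simp: b z' z algebra_simps)
    ultimately show False by simp
  qed
  have "S - terms P = {#}"
  proof (rule ccontr)
    assume "S - terms P \<noteq> {#}"
    then obtain c where c: "c \<in># S - terms P" by blast
    have 1: "c - a \<in> K" using rest_in_coset[OF P j1 c] by (simp add: ab)
    have 2: "c - z \<in> K" using rest_in_coset[OF P' j2 c] by (simp add: zz)
    from stab_diff[OF 1 2] show False using naz by simp
  qed
  then have "S = terms P" using terms_P by (simp add: Diff_eq_empty_iff_mset subset_mset.antisym)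
  then have "S = {#a, a + g, a + y, a + y + g#}"
    by (simp add: P \<open>B = {#}\<close> ab zz b z' z)
  moreover have "y \<noteq> 0" "y \<noteq> g" using yK g by auto
  ultimately show ?thesis using m2 g gg yy unfolding klein_def by blast
qed

text \<open>Outside the Klein case all redundant pairs lie in the coset of one fixed redundant pair
  \<open>j0\<close>. A pair that is not redundant meets this coset by
  \<open>pair_meets_coset\<close> if the others are redundant without it; otherwise the number of
  sums is forced to be \<open>m + 1\<close> and \<open>same_coset_of_full\<close> applies.\<close>

lemma klein_or_coset:
  "(\<exists>a g y. klein a g y) \<or>
   (\<exists>x. (\<forall>p\<in>#P. fst p - x \<in> K \<or> snd p - x \<in> K) \<and> (\<forall>c\<in>#S - terms P. c - x \<in> K))"
proof (cases "\<exists>a g y. klein a g y")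
  case nk: False
  have same: "fst j1 - fst j2 \<in> K"
    if jj: "P = add_mset j1 B1" "pair_diff j1 \<in> stab (psum B1)" "P = add_mset j2 B2" "pair_diff j2 \<in> stab (psum B2)"
    for j1 j2 B1 B2
  proof (cases "j1 = j2")
    case False
    then obtain B where "B1 = add_mset j2 B" "B2 = add_mset j1 B"
      using jj(1,3) by (metis add_eq_conv_ex)
    then show ?thesis using klein_of_two_cosets[of j1 j2 B] jj nk by blast
  qed simp
  obtain j0 B0 where j0: "P = add_mset j0 B0" "pair_diff j0 \<in> stab (psum B0)"
    using red unfolding redundant_def by (metis insert_DiffM)
  have j0K: "pair_diff j0 \<in> K" using j0 stab_psum_add[of B0 j0] by auto
  have "fst i - fst j0 \<in> K \<or> snd i - fst j0 \<in> K" if "i \<in># P" for i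
  proof -
    obtain R where R: "P = add_mset i R" using \<open>i \<in># P\<close> by (metis insert_DiffM)
    consider "pair_diff i \<in> stab (psum R)" | "redundant R" | "pair_diff i \<notin> stab (psum R)" "\<not> redundant R" by blast
    then show ?thesis
    proof cases
      case 1
      then show ?thesis using same[OF R 1 j0] by simp
    next
      case 2
      then obtain j R' where j: "R = add_mset j R'" "pair_diff j \<in> stab (psum R')"
        unfolding redundant_def by (metis insert_DiffM)
      have "P = add_mset j (add_mset i R')" by (simp add: R j add_mset_commute)
      moreover have "pair_diff j \<in> stab (psum (add_mset i R'))" using j stab_psum_add by blast
      ultimately have "fst j - fst j0 \<in> K" using same j0 by blast
      moreover have "fst i - fst j \<in> K \<or> snd i - fst j \<in> K"
        by (rule pair_meets_coset[of i j R']) (use R j in auto)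
      ultimately show ?thesis using stab_plus[of "fst i - fst j" "psum P" "fst j - fst j0"]
          stab_plus[of "snd i - fst j" "psum P" "fst j - fst j0"] by auto
    next
      case 3
      \<comment> \<open>The \<open>m - 1\<close> pairs of \<open>R\<close> have at least
        \<open>m\<close> sums, and \<open>i\<close> gains at least one more. Hence \<open>i\<close>
        gains exactly one, and its difference is a period.\<close>
      have "m \<le> card (psum R)" using card_psum_not_redundant_ge[OF 3(2)] size_P R by simp
      moreover have "card (psum R) < card (psum P)" using card_psum_add_less[OF 3(1)] R by simp
      ultimately have c: "card (psum P) = m + 1" "card (psum P) \<le> card (psum R) + 1"
        using le by auto
      have "K \<noteq> {0}" using j0K diff_nz[of j0] j0(1) by auto
      then have iK: "pair_diff i \<in> K" using pair_diff_stab_of_card_Suc[of i R] c R by simp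
      show ?thesis
      proof (cases "i = j0")
        case False
        then obtain B where "P = add_mset i (add_mset j0 B)"
          using R j0(1) by (metis add_eq_conv_ex)
        from same_coset_of_full[OF this iK j0K c(1)] show ?thesis ..
      qed simp
    qed
  qed
  moreover have "c - fst j0 \<in> K" if "c \<in># S - terms P" for c
    by (rule rest_in_coset[OF j0 that])
  ultimately show ?thesis by blast
qed simp

end

section \<open>Subsequence sums\<close>

lemma SigmaN_eq_image: "SigmaN n S = sum_mset ` {T. T \<subseteq># S \<and> size T = n}"
  by (auto simp: SigmaN_def)

lemma subset_add_mset_notin: "T \<subseteq># add_mset v M \<Longrightarrow> v \<notin># T \<Longrightarrow> T \<subseteq># M"
  unfolding subseteq_mset_def by (metis count_add_mset count_eq_zero_iff le0)

lemma finite_submultisets: "finite {T. T \<subseteq># S}"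
proof (induction S)
  case (add x S)
  have "{T. T \<subseteq># add_mset x S} \<subseteq> {T. T \<subseteq># S} \<union> add_mset x ` {T. T \<subseteq># S}"
  proof
    fix T assume "T \<in> {T. T \<subseteq># add_mset x S}"
    then have T: "T \<subseteq># add_mset x S" by simp
    show "T \<in> {T. T \<subseteq># S} \<union> add_mset x ` {T. T \<subseteq># S}"
    proof (cases "x \<in># T")
      case True
      then obtain T' where "T = add_mset x T'" by (metis insert_DiffM)
      then show ?thesis using T by auto
    next
      case False
      then have "T \<subseteq># S" using T subset_add_mset_notin by metis
      then show ?thesis by simp
    qed
  qed
  then show ?case using add by (meson finite_UnI finite_imageI finite_subset)
qed simp

lemma finite_SigmaN [simp]: "finite (SigmaN n S)"
  unfolding SigmaN_eq_image by (rule finite_imageI, rule finite_subset[OF _ finite_submultisets]) blast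

lemma psum_submultiset:
  "x \<in> psum P \<Longrightarrow> \<exists>T. T \<subseteq># terms P \<and> size T = size P \<and> sum_mset T = x"
proof (induction P arbitrary: x)
  case (add p P)
  then consider "x - fst p \<in> psum P" | "x - snd p \<in> psum P" by auto
  then show ?case
  proof cases
    case 1
    then obtain T where "T \<subseteq># terms P" "size T = size P" "sum_mset T = x - fst p" using add.IH by blast
    then show ?thesis
      by (intro exI[of _ "add_mset (fst p) T"]) (auto intro: subset_mset.order_trans)
  next
    case 2
    then obtain T where "T \<subseteq># terms P" "size T = size P" "sum_mset T = x - snd p" using add.IH by blast
    then show ?thesis
      by (intro exI[of _ "add_mset (snd p) T"])
        (auto simp: add_mset_commute[of "fst p"] intro: subset_mset.order_trans)
  qed
qed simp

lemma psum_subset_SigmaN: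
  assumes "terms P + U \<subseteq># S" "size P + size U = n"
  shows "(+) (sum_mset U) ` psum P \<subseteq> SigmaN n S"
proof
  fix x assume "x \<in> (+) (sum_mset U) ` psum P"
  then obtain T where T: "T \<subseteq># terms P" "size T = size P" "x = sum_mset U + sum_mset T"
    using psum_submultiset by blast
  have "T + U \<subseteq># S" using T(1) assms(1) by (meson subset_mset.add_right_mono subset_mset.order_trans)
  then show "x \<in> SigmaN n S"
    unfolding SigmaN_def using T assms(2) by (auto intro!: exI[of _ "T + U"] simp: add.commute)
qed

text \<open>Every pair meets \<open>x + K\<close>, so it has at most one term outside. Choose that
  term when it is still to be accounted for in \<open>T\<close>, and the term in the coset
  otherwise; the latter contributes nothing modulo \<open>K\<close>. One copy of \<open>x\<close> is
  subtracted for each pair.\<close>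

lemma sum_outside_coset_in_psum:
  assumes K: "is_subgroup K" and "\<forall>p\<in>#P. fst p - x \<in> K \<or> snd p - x \<in> K"
    and "T \<subseteq># {#t \<in># terms P. t - x \<notin> K#}"
  shows "\<exists>s\<in>psum P. (\<Sum>t\<in>#T. t - x) - (s - sum_mset (replicate_mset (size P) x)) \<in> K"
  using assms(2,3)
proof (induction P arbitrary: T)
  case empty
  then show ?case using K by (simp add: is_subgroup_def)
next
  case (add p P)
  \<comment> \<open>Here \<open>w\<close> is an entry of \<open>p\<close> in the coset and
    \<open>v\<close> is the other entry.\<close>
  obtain w v where wv: "w - x \<in> K" "terms (add_mset p P) = add_mset w (add_mset v (terms P))"
    "\<And>s. s \<in> psum P \<Longrightarrow> w + s \<in> psum (add_mset p P) \<and> v + s \<in> psum (add_mset p P)"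
  proof (cases "fst p - x \<in> K")
    case True
    then show thesis by (intro that[of "fst p" "snd p"]) auto
  next
    case False
    then show thesis using add.prems
      by (intro that[of "snd p" "fst p"]) auto
  qed
  have T: "T \<subseteq># {#t \<in># add_mset w (add_mset v (terms P)). t - x \<notin> K#}"
    using add.prems(2) unfolding wv(2) .
  let ?c = "sum_mset (replicate_mset (size P) x)"
  have neg: "- (w - x) \<in> K" using wv(1) K unfolding is_subgroup_def by blast
  show ?case
  proof (cases "v \<in># T \<and> v - x \<notin> K")
    case True
    then obtain T' where T': "T = add_mset v T'" by (metis insert_DiffM)
    then have "T' \<subseteq># {#t \<in># terms P. t - x \<notin> K#}"
      using T True wv(1) T' by simp
    then obtain s where s: "s \<in> psum P" "(\<Sum>t\<in>#T'. t - x) - (s - ?c) \<in> K"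
      using add by (metis insert_iff set_mset_add_mset_insert)
    have "(\<Sum>t\<in>#T. t - x) - (v + s - sum_mset (replicate_mset (size (add_mset p P)) x)) =
      (\<Sum>t\<in>#T'. t - x) - (s - ?c)"
      by (simp add: T' algebra_simps)
    then have "(\<Sum>t\<in>#T. t - x) - (v + s - sum_mset (replicate_mset (size (add_mset p P)) x)) \<in> K"
      using s(2) by (simp only:)
    then show ?thesis using s(1) wv(3) by blast
  next
    case False
    have "T \<subseteq># {#t \<in># terms P. t - x \<notin> K#}"
    proof (cases "v - x \<in> K")
      case True
      then show ?thesis using T wv(1) True by simp
    next
      case nK: False
      then have "T \<subseteq># add_mset v {#t \<in># terms P. t - x \<notin> K#}" "v \<notin># T"
        using T wv(1) False by simp_all
      then show ?thesis
        by (rule subset_add_mset_notin)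
    qed
    then obtain s where s: "s \<in> psum P" "(\<Sum>t\<in>#T. t - x) - (s - ?c) \<in> K"
      using add by (metis insert_iff set_mset_add_mset_insert)
    have "- (w - x) + ((\<Sum>t\<in>#T. t - x) - (s - ?c)) \<in> K"
      using neg s(2) K unfolding is_subgroup_def by blast
    moreover have "- (w - x) + ((\<Sum>t\<in>#T. t - x) - (s - ?c)) =
      (\<Sum>t\<in>#T. t - x) - (w + s - sum_mset (replicate_mset (size (add_mset p P)) x))"
      by (simp add: algebra_simps)
    ultimately have "(\<Sum>t\<in>#T. t - x) - (w + s - sum_mset (replicate_mset (size (add_mset p P)) x)) \<in> K"
      by (simp only:)
    then show ?thesis using s(1) wv(3) by blast
  qed
qed

lemma sum_in_subgroup:
  "is_subgroup K \<Longrightarrow> \<forall>t\<in>#T. f t \<in> K \<Longrightarrow> (\<Sum>t\<in>#T. f t) \<in> K"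
  by (induction T) (auto simp: is_subgroup_def)

lemma sum_mset_translate:
  fixes x :: "'a::ab_group_add"
  shows "sum_mset T = (\<Sum>t\<in>#T. t - x) + sum_mset (replicate_mset (size T) x)"
  by (induction T) (auto simp: algebra_simps)

text \<open>Modulo \<open>K\<close>, and after subtracting \<open>x\<close> from each term, a sum of
  \<open>n\<close> terms depends only on its terms outside \<open>x + K\<close>. These all belong to
  pairs, so some choice from the pairs has the same class, and \<open>psum P\<close> is a union of
  cosets of \<open>K\<close>.\<close>

lemma SigmaN_eq_psum:
  assumes terms: "terms P \<subseteq># S" and U: "U \<subseteq># S - terms P" and n: "size P + size U = n"
    and meets: "\<forall>p\<in>#P. fst p - x \<in> stab (psum P) \<or> snd p - x \<in> stab (psum P)"
    and rest: "\<forall>c\<in>#S - terms P. c - x \<in> stab (psum P)"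
  shows "SigmaN n S = (+) (sum_mset U) ` psum P"
proof
  let ?K = "stab (psum P)"
  let ?c = "\<lambda>k. sum_mset (replicate_mset k x)"
  have "terms P + U \<subseteq># S" using terms U by (metis subset_mset.add_left_mono subset_mset.add_diff_inverse)
  then show "(+) (sum_mset U) ` psum P \<subseteq> SigmaN n S" using n by (rule psum_subset_SigmaN)
  show "SigmaN n S \<subseteq> (+) (sum_mset U) ` psum P"
  proof
    fix y assume "y \<in> SigmaN n S"
    then obtain T where T: "T \<subseteq># S" "size T = n" "y = sum_mset T" by (auto simp: SigmaN_def)
    have S: "S = terms P + (S - terms P)" using terms by simp
    have "set_mset {#t \<in># S - terms P. t - x \<notin> ?K#} = {}"
      unfolding set_mset_filter using rest by blast
    then have "{#t \<in># S - terms P. t - x \<notin> ?K#} = {#}" by (simp only: set_mset_eq_empty_iff)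
    then have "{#t \<in># S. t - x \<notin> ?K#} = {#t \<in># terms P. t - x \<notin> ?K#}"
      by (subst S) (simp only: filter_union_mset add_0_right)
    then have "{#t \<in># T. t - x \<notin> ?K#} \<subseteq># {#t \<in># terms P. t - x \<notin> ?K#}"
      using T(1) by (metis multiset_filter_mono)
    then obtain s where s: "s \<in> psum P"
      "(\<Sum>t\<in>#{#t \<in># T. t - x \<notin> ?K#}. t - x) - (s - ?c (size P)) \<in> ?K"
      using sum_outside_coset_in_psum[OF is_subgroup_stab meets] by blast
    have "(\<Sum>t\<in>#{#t \<in># T. t - x \<in> ?K#}. t - x) \<in> ?K"
      by (rule sum_in_subgroup) (auto simp: is_subgroup_stab)
    moreover have "(\<Sum>t\<in>#T. t - x) =
      (\<Sum>t\<in>#{#t \<in># T. t - x \<in> ?K#}. t - x) + (\<Sum>t\<in>#{#t \<in># T. t - x \<notin> ?K#}. t - x)"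
      by (subst multiset_partition[of T "\<lambda>t. t - x \<in> ?K"])
        (simp only: image_mset_union sum_mset.union)
    ultimately have 1: "(\<Sum>t\<in>#T. t - x) - (s - ?c (size P)) \<in> ?K"
      using stab_plus[OF _ s(2)] by (simp only: add_diff_eq)
    have 2: "(\<Sum>t\<in>#U. t - x) \<in> ?K"
      by (rule sum_in_subgroup) (use rest mset_subset_eqD[OF U] in \<open>auto simp: is_subgroup_stab\<close>)
    \<comment> \<open>Both sides consist of \<open>n\<close> terms, so the subtracted copies of
      \<open>x\<close> cancel.\<close>
    have "?c (k + l) = ?c k + ?c l" for k l by (induction k) (simp_all add: add.assoc)
    then have "?c n = ?c (size P) + ?c (size U)" using n by metis
    then have "y - sum_mset U - s = (\<Sum>t\<in>#T. t - x) - (s - ?c (size P)) - (\<Sum>t\<in>#U. t - x)"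
      using sum_mset_translate[of T x] sum_mset_translate[of U x] T by (simp add: algebra_simps)
    then have "y - sum_mset U - s \<in> ?K" using stab_diff[OF 1 2] by (simp only:)
    from stab_add[OF this s(1)] show "y \<in> (+) (sum_mset U) ` psum P" by (simp add: mem_image_plus)
  qed
qed

section \<open>Maximal multiplicity and the existence of pairings\<close>

lemma count_le_hS: "count S x \<le> hS S"
  unfolding hS_def by (cases "x \<in># S") (auto intro!: Max_ge simp: not_in_iff)

lemma hS_le_size: "hS S \<le> size S"
  unfolding hS_def by (auto intro: count_le_size)

lemma hS_attained: "S \<noteq> {#} \<Longrightarrow> \<exists>x\<in>#S. count S x = hS S"
proof -
  assume "S \<noteq> {#}"
  then obtain y where y: "y \<in># S" by blast
  have "hS S \<in> insert 0 (count S ` set_mset S)" unfolding hS_def by (rule Max_in) auto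
  moreover have "hS S \<noteq> 0" using y count_le_hS[of S y] count_greater_zero_iff[of S y] by linarith
  ultimately show ?thesis by auto
qed

text \<open>Greedy choice: a most frequent term is paired with a different one, which preserves both
  inequalities for the remaining sequence.\<close>

lemma ex_pairing:
  "2 * m \<le> size S \<Longrightarrow> m + hS S \<le> size S \<Longrightarrow> \<exists>P. pairing S m P"
proof (induction m arbitrary: S)
  case 0
  then show ?case by (auto simp: pairing_def intro!: exI[of _ "{#}"])
next
  case (Suc m)
  then have "S \<noteq> {#}" by auto
  then obtain x where x: "x \<in># S" "count S x = hS S" using hS_attained by blast
  obtain S1 where S1: "S = add_mset x S1" using x(1) by (metis insert_DiffM)
  have "\<exists>y\<in>#S1. y \<noteq> x"
  proof (rule ccontr)
    assume "\<not> ?thesis"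
    then have "count S x = size S"
      unfolding S1 by (metis count_replicate_mset set_mset_subset_singletonD size_add_mset
          singletonI subsetI size_replicate_mset count_add_mset insert_iff)
    then show False using Suc.prems x by simp
  qed
  then obtain y S2 where y: "y \<noteq> x" "S1 = add_mset y S2" by (metis insert_DiffM)
  have S: "S = add_mset x (add_mset y S2)" using S1 y by simp
  have "m + hS S2 \<le> size S2"
  proof (cases "S2 = {#}")
    case True
    then show ?thesis using Suc.prems S by (simp add: hS_def)
  next
    case False
    then obtain z where z: "z \<in># S2" "count S2 z = hS S2" using hS_attained by blast
    show ?thesis
    proof (cases "z = x \<or> z = y")
      case True
      then have "count S z = Suc (hS S2)" using z y S by auto
      then show ?thesis using Suc.prems(2) count_le_hS[of S z] S by simp
    next
      case False
      \<comment> \<open>The multiplicity of \<open>z\<close> is unchanged, but at least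
        \<open>hS S2 - 1\<close> copies of \<open>x\<close> remain. So \<open>2 * hS S2 - 1\<close>
        is at most \<open>size S2\<close>; adding \<open>2 * m <= size S2\<close> and using parity
        gives the claim.\<close>
      have "count S2 z + count S2 x \<le> size S2"
      proof -
        have "replicate_mset (count S2 z) z + replicate_mset (count S2 x) x \<subseteq># S2"
          using False by (auto simp: subseteq_mset_def)
        from size_mset_mono[OF this] show ?thesis by simp
      qed
      moreover have "count S z = count S2 z" "count S x = Suc (count S2 x)" using False y S by auto
      ultimately show ?thesis using Suc.prems x count_le_hS[of S z] z S by simp
    qed
  qed
  then obtain P where "pairing S2 m P" using Suc.IH[of S2] Suc.prems S by auto
  then have "pairing S (Suc m) (add_mset (x, y) P)" using y S by (auto simp: pairing_def)
  then show ?case ..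
qed

section \<open>Pairings without redundancy\<close>

text \<open>Every further pair gains at least one sum, so the two pairs have exactly three. Their
  four formal sums then collide exactly once: equal or opposite differences are needed for one
  collision, and a difference of order 2 would cause a second.\<close>

lemma pair_diff_of_card_3:
  assumes nr: "\<not> redundant P" and card: "card (psum P) = size P + 1" and pq: "{#p, q#} \<subseteq># P"
  shows "pair_diff q = pair_diff p \<or> pair_diff q = - pair_diff p" "pair_diff p + pair_diff p \<noteq> 0"
proof -
  let ?s = "fst p + fst q"
  have nr2: "\<not> redundant {#p, q#}" using nr redundant_mono[OF pq] by blast
  have "2 \<le> size P" using size_mset_mono[OF pq] by simp
  then have c: "card (psum {#p, q#}) = 3"
    using card_psum_not_redundant[OF nr pq] card card_psum_not_redundant_ge[OF nr2] by simp
  have nz: "pair_diff p \<noteq> 0" "pair_diff q \<noteq> 0" using nr2 unfolding redundant_def by auto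
  have eq: "psum {#p, q#} = {?s, ?s + pair_diff p, ?s + pair_diff q, ?s + pair_diff p + pair_diff q}"
    by (auto simp: pair_diff_def diff_eq_eq algebra_simps)
  show "pair_diff q = pair_diff p \<or> pair_diff q = - pair_diff p"
  proof (rule ccontr)
    assume "\<not> ?thesis"
    then have "pair_diff p \<noteq> pair_diff q" "pair_diff p + pair_diff q \<noteq> 0" by (auto simp: eq_neg_iff_add_eq_0 add.commute)
    then have "card (psum {#p, q#}) = 4" unfolding eq using nz by (simp add: add.assoc)
    then show False using c by simp
  qed
  then have dq: "pair_diff q = pair_diff p" if "pair_diff p + pair_diff p = 0"
    using that by (metis neg_eq_iff_add_eq_0)
  show "pair_diff p + pair_diff p \<noteq> 0"
  proof
    assume 0: "pair_diff p + pair_diff p = 0"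
    then have "psum {#p, q#} = {?s, ?s + pair_diff p}" unfolding eq dq[OF 0] by (auto simp: add.assoc)
    then have "card (psum {#p, q#}) \<le> 2" by (simp add: card_insert_if)
    then show False using c by simp
  qed
qed

lemma submset_eq_of_size: "A \<subseteq># B \<Longrightarrow> size A = size B \<Longrightarrow> A = B"
  by (metis mset_subset_size nat_less_le subset_mset.less_le)

lemma count_terms_one_each:
  "\<forall>p\<in>#P. (fst p = x) \<noteq> (snd p = x) \<Longrightarrow> count (terms P) x = size P"
  by (induction P) auto

text \<open>The assumptions range over all pairings because the arguments compare \<open>P\<close>
  with pairings obtained from it by exchanges. At least two pairs are needed to compare
  differences.\<close>

locale tight_pairing =
  fixes S :: "'a::ab_group_add multiset" and m :: nat and P :: "('a \<times> 'a) multiset"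
  assumes pairing: "pairing S m P" and m2: "2 \<le> m" and card_P: "card (psum P) = m + 1"
    and le: "pairing S m P' \<Longrightarrow> card (psum P') \<le> m + 1"
    and not_red: "pairing S m P' \<Longrightarrow> card (psum P') = m + 1 \<Longrightarrow> \<not> redundant P'"
    and full: "terms P' = terms P \<Longrightarrow> psum P' \<subseteq> psum P"
begin

lemma size_P: "size P = m" and terms_P: "terms P \<subseteq># S" and diff_nz: "p \<in># P \<Longrightarrow> pair_diff p \<noteq> 0"
  using pairing by (auto simp: pairing_def pair_diff_def)

lemma diff_P:
  assumes "p \<in># P" "q \<in># P"
  shows "pair_diff q = pair_diff p \<or> pair_diff q = - pair_diff p" and "pair_diff p + pair_diff p \<noteq> 0"
proof -
  have *: "(pair_diff q = pair_diff p \<or> pair_diff q = - pair_diff p) \<and> pair_diff p + pair_diff p \<noteq> 0" if "P = add_mset p (add_mset q B)" for p q B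
    using pair_diff_of_card_3[OF not_red[OF pairing card_P], of p q] card_P size_P that by simp
  obtain B where B: "P = add_mset p B" using assms(1) by (metis insert_DiffM)
  show "pair_diff q = pair_diff p \<or> pair_diff q = - pair_diff p"
  proof (cases "q = p")
    case False
    then obtain B' where "B = add_mset q B'" using assms(2) B by (metis insert_DiffM insert_noteq_member)
    then show ?thesis using * B by blast
  qed simp
  have "B \<noteq> {#}" using B size_P m2 by auto
  then obtain r B' where "B = add_mset r B'" by (cases B) auto
  then show "pair_diff p + pair_diff p \<noteq> 0" using * B by blast
qed

text \<open>A pair of \<open>P\<close> inside the violating subfamily would put the common
  difference, up to sign, into its stabiliser. All \<open>m + 1\<close> sums of \<open>P\<close>
  would then lie in one coset of a group of order at most \<open>m\<close>.\<close>

lemma violating_outside: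
  assumes pairing': "pairing S m (R + B)" and "card (psum (R + B)) \<le> m" and B: "B \<subseteq># P"
  shows "\<exists>Q. Q \<subseteq># R \<and> Q \<noteq> {#} \<and> (\<forall>q\<in>#Q. pair_diff q \<in> stab (psum Q)) \<and> card (stab (psum Q)) = size Q"
proof -
  have "card (psum (R + B)) \<le> size (R + B)" using assms by (simp add: pairing_def)
  then obtain Q where Q: "Q \<subseteq># R + B" "Q \<noteq> {#}" "\<forall>q\<in>#Q. pair_diff q \<in> stab (psum Q)"
    "card (stab (psum Q)) = size Q"
    using violating_subgroup by blast
  have out: "p \<notin># Q" if "p \<in># P" for p
  proof
    assume "p \<in># Q"
    then have p: "pair_diff p \<in> stab (psum Q)" using Q(3) by blast
    have "card (psum P) \<le> card (stab (psum Q))"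
    proof (rule card_psum_le_subgroup)
      fix q assume "q \<in># P"
      then show "pair_diff q \<in> stab (psum Q)" using diff_P(1)[OF that] p stab_uminus[OF p] by metis
    qed (auto simp: is_subgroup_stab finite_stab)
    then show False using size_mset_mono[OF Q(1)] pairing' card_P Q(4) by (simp add: pairing_def)
  qed
  have "Q \<subseteq># R"
  proof (rule mset_subset_eqI)
    fix q
    show "count Q q \<le> count R q"
    proof (cases "q \<in># B")
      case True
      then have "q \<notin># Q" using out mset_subset_eqD[OF B] by blast
      then show ?thesis by (simp add: not_in_iff)
    next
      case False
      then show ?thesis using mset_subset_eq_count[OF Q(1), of q] by (simp add: not_in_iff)
    qed
  qed
  then show ?thesis using Q by blast
qed

text \<open>With \<open>m + 1\<close> sums the new pair is compared with a surviving one. With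
  fewer, the new pair alone would be violating, so its nonzero difference would lie in a group of
  order 1.\<close>

lemma replace_one:
  assumes P: "P = add_mset p B" and pairing': "pairing S m (add_mset r B)"
  shows "pair_diff r = pair_diff p \<or> pair_diff r = - pair_diff p"
proof (rule ccontr)
  assume r: "\<not> ?thesis"
  have rz: "pair_diff r \<noteq> 0" using pairing' by (auto simp: pairing_def pair_diff_def)
  have "B \<noteq> {#}" using P size_P m2 by auto
  then obtain b B' where B: "B = add_mset b B'" by (cases B) auto
  show False
  proof (cases "card (psum (add_mset r B)) = m + 1")
    case True
    then have "pair_diff r = pair_diff b \<or> pair_diff r = - pair_diff b"
      using pair_diff_of_card_3(1)[OF not_red[OF pairing' True], of b r] size_P
      by (simp add: P B add_mset_commute)
    moreover have "pair_diff b = pair_diff p \<or> pair_diff b = - pair_diff p" using diff_P(1)[of p b] by (simp add: P B)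
    ultimately show False using r by auto
  next
    case False
    then have "card (psum (add_mset r B)) \<le> m" using le[OF pairing'] by simp
    then obtain Q where
      Q: "Q \<subseteq># {#r#}" "Q \<noteq> {#}" "\<forall>q\<in>#Q. pair_diff q \<in> stab (psum Q)" "card (stab (psum Q)) = size Q"
      using violating_outside[of "{#r#}" B] pairing' by (auto simp: P)
    have "size Q \<noteq> 0" using Q(2) by simp
    then have "Q = {#r#}" using Q(1) size_mset_mono[OF Q(1)] by (intro submset_eq_of_size) (auto simp del: size_eq_0_iff_empty)
    then have "card (stab (psum Q)) = 1" "pair_diff r \<in> stab (psum Q)" using Q by auto
    then have "stab (psum Q) = {0}" by (metis card_1_singletonE singletonD zero_stab)
    then show False using rz \<open>pair_diff r \<in> stab (psum Q)\<close> by simp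
  qed
qed

text \<open>Either the new pairing is tight, or the violating subfamily consists of both new pairs
  and its stabiliser has order 2, with their common difference as nonzero element. Comparison with
  the old difference needs a surviving pair, hence the condition on \<open>B\<close>.\<close>

lemma replace_two:
  assumes P: "P = add_mset p (add_mset q B)" and pairing': "pairing S m (add_mset r1 (add_mset r2 B))"
  shows "card (psum (add_mset r1 (add_mset r2 B))) = m + 1 \<and> (pair_diff r2 = pair_diff r1 \<or> pair_diff r2 = - pair_diff r1) \<and>
       pair_diff r1 + pair_diff r1 \<noteq> 0 \<and>
       (B \<noteq> {#} \<longrightarrow> (pair_diff r1 = pair_diff p \<or> pair_diff r1 = - pair_diff p) \<and> (pair_diff r2 = pair_diff p \<or> pair_diff r2 = - pair_diff p)) \<or>
     card (psum (add_mset r1 (add_mset r2 B))) \<le> m \<and> pair_diff r1 = pair_diff r2 \<and> pair_diff r1 + pair_diff r1 = 0"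
proof (cases "card (psum (add_mset r1 (add_mset r2 B))) = m + 1")
  case True
  let ?P = "add_mset r1 (add_mset r2 B)"
  have nr: "\<not> redundant ?P" by (rule not_red[OF pairing' True])
  have sz: "card (psum ?P) = size ?P + 1" using True size_P by (simp add: P)
  have 1: "pair_diff r2 = pair_diff r1 \<or> pair_diff r2 = - pair_diff r1" "pair_diff r1 + pair_diff r1 \<noteq> 0"
    using pair_diff_of_card_3[OF nr sz, of r1 r2] by simp_all
  have "(pair_diff r1 = pair_diff p \<or> pair_diff r1 = - pair_diff p) \<and> (pair_diff r2 = pair_diff p \<or> pair_diff r2 = - pair_diff p)" if "B \<noteq> {#}"
  proof -
    obtain b B' where B: "B = add_mset b B'" using \<open>B \<noteq> {#}\<close> by (cases B) auto
    have "pair_diff b = pair_diff p \<or> pair_diff b = - pair_diff p" using diff_P(1)[of p b] by (simp add: P B)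
    moreover have "pair_diff r1 = pair_diff b \<or> pair_diff r1 = - pair_diff b"
      by (rule pair_diff_of_card_3(1)[OF nr sz]) (simp add: B add_mset_commute[of b])
    moreover have "pair_diff r2 = pair_diff b \<or> pair_diff r2 = - pair_diff b"
      by (rule pair_diff_of_card_3(1)[OF nr sz]) (simp add: B add_mset_commute[of b])
    ultimately show ?thesis by auto
  qed
  then show ?thesis using 1 True by blast
next
  case False
  let ?P = "add_mset r1 (add_mset r2 B)"
  have c: "card (psum ?P) \<le> m" using False le[OF pairing'] by simp
  have rz: "pair_diff r1 \<noteq> 0" "pair_diff r2 \<noteq> 0" using pairing' by (auto simp: pairing_def pair_diff_def)
  obtain Q where sub: "Q \<subseteq># {#r1, r2#}" and
    Q: "Q \<noteq> {#}" "\<forall>q\<in>#Q. pair_diff q \<in> stab (psum Q)" "card (stab (psum Q)) = size Q"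
    using violating_outside[of "{#r1, r2#}" B] pairing' c by (auto simp: P subset_mset.add_increasing)
  have "size Q \<noteq> 1"
  proof
    assume "size Q = 1"
    then have "stab (psum Q) = {0}" using Q(3) by (metis card_1_singletonE singletonD zero_stab)
    moreover obtain q where "q \<in># Q" using Q(1) by blast
    moreover have "q = r1 \<or> q = r2" using mset_subset_eqD[OF sub \<open>q \<in># Q\<close>] by simp
    ultimately show False using Q(2) rz by auto
  qed
  moreover have "size Q \<noteq> 0" using Q(1) by simp
  moreover have "size Q \<le> 2" using size_mset_mono[OF sub] by simp
  ultimately have "size Q = 2" by linarith
  then have Qeq: "Q = {#r1, r2#}" using sub by (intro submset_eq_of_size) auto
  have fin: "finite (stab (psum Q))" by (rule finite_stab) auto
  have r: "pair_diff r1 \<in> stab (psum Q)" "pair_diff r2 \<in> stab (psum Q)" using Q(2) Qeq by auto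
  have only: "k = pair_diff r1" if "k \<in> stab (psum Q)" "k \<noteq> 0" for k
  proof (rule ccontr)
    assume "k \<noteq> pair_diff r1"
    then have "card {0, k, pair_diff r1} = 3" using that rz by simp
    moreover have "card {0, k, pair_diff r1} \<le> card (stab (psum Q))"
      using that r fin by (intro card_mono) auto
    ultimately show False using Q(3) \<open>size Q = 2\<close> by simp
  qed
  have "pair_diff r2 = pair_diff r1" using only[OF r(2) rz(2)] .
  moreover have "pair_diff r1 + pair_diff r1 = 0"
  proof (rule ccontr)
    assume "pair_diff r1 + pair_diff r1 \<noteq> 0"
    then have "pair_diff r1 + pair_diff r1 = pair_diff r1" by (rule only[OF stab_plus[OF r(1) r(1)]])
    then show False using rz by simp
  qed
  ultimately show ?thesis using c by simp
qed

text \<open>The four terms are re-paired in the two other ways, with \<open>e = c - a\<close>.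
  Crosswise the differences \<open>e + \<delta>\<close> and \<open>e - \<delta>\<close> are unequal,
  so they are opposite and \<open>e + e = 0\<close>. Lengthwise both differences are
  \<open>e\<close>, so that pairing has at most \<open>m\<close> sums. These facts are incompatible,
  for different reasons with and without further pairs.\<close>

lemma no_parallel_pairs:
  assumes P: "P = add_mset (a, a + \<delta>) (add_mset q B)" and q: "q = (c, c + \<delta>) \<or> q = (c + \<delta>, c)"
    and ne: "c \<noteq> a" "c \<noteq> a + \<delta>" "c + \<delta> \<noteq> a"
  shows False
proof -
  define e where "e = c - a"
  have c: "c = a + e" by (simp add: e_def)
  have ez: "e \<noteq> 0" "e \<noteq> \<delta>" "e + \<delta> \<noteq> 0" using ne by (auto simp: c add.assoc)
  have dd: "\<delta> + \<delta> \<noteq> 0" using diff_P(2)[of "(a, a + \<delta>)" "(a, a + \<delta>)"] by (simp add: P)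
  then have dz: "\<delta> \<noteq> 0" by auto
  have elsP: "terms P = add_mset a (add_mset (a + \<delta>) (add_mset c (add_mset (c + \<delta>) (terms B))))"
    using q by (auto simp: P add_mset_commute)
  let ?P1 = "add_mset (a, c + \<delta>) (add_mset (a + \<delta>, c) B)"
  let ?P2 = "add_mset (a, c) (add_mset (a + \<delta>, c + \<delta>) B)"
  have els1: "terms ?P1 = terms P" unfolding elsP by (simp add: add_mset_commute)
  have els2: "terms ?P2 = terms P" unfolding elsP by (simp add: add_mset_commute)
  have cfg1: "pairing S m ?P1" using pairing ne unfolding pairing_def els1 by (auto simp: P)
  have cfg2: "pairing S m ?P2" using pairing ne unfolding pairing_def els2 by (auto simp: P)
  have r1: "pair_diff (a, c + \<delta>) = e + \<delta>" "pair_diff (a + \<delta>, c) = e - \<delta>" by (simp_all add: c algebra_simps)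
  have r2: "pair_diff (a, c) = e" "pair_diff (a + \<delta>, c + \<delta>) = e" by (simp_all add: c algebra_simps)
  have x1: "e + \<delta> \<noteq> e - \<delta>"
    using dd by (metis add_diff_cancel_left' diff_add_cancel add.assoc diff_self right_minus_eq add.right_neutral)
  have one: "e - \<delta> = - (e + \<delta>) \<and> (B \<noteq> {#} \<longrightarrow> (e + \<delta> = \<delta> \<or> e + \<delta> = - \<delta>))"
    using replace_two[OF P cfg1] x1 unfolding r1 by auto
  then have ee: "e + e = 0" by (simp add: algebra_simps eq_neg_iff_add_eq_0)
  then have two: "card (psum ?P2) \<le> m" using replace_two[OF P cfg2] unfolding r2 by auto
  show False
  proof (cases "B = {#}")
    case True
    \<comment> \<open>The sum \<open>a + (a + \<delta>)\<close> uses both entries of one old pair;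
      as the sums are exhausted it must also arise by choosing from the old pairs.\<close>
    have "a + (a + \<delta>) \<in> psum ?P1" using True by simp
    then have "a + (a + \<delta>) \<in> psum P" using full[OF els1] by blast
    then have "\<delta> = e \<or> e + \<delta> = 0 \<or> e = 0"
      using q by (auto simp: P True c algebra_simps)
    then show False using ez by auto
  next
    case False
    then have ed: "e = - \<delta> - \<delta>" using one ez by (auto simp: algebra_simps)
    have "\<delta> + \<delta> + \<delta> + \<delta> = - (e + e)" unfolding ed by (simp add: algebra_simps)
    then have d4: "\<delta> + \<delta> + \<delta> + \<delta> = 0" using ee by simp
    have d4': "\<delta> + (\<delta> + (\<delta> + (\<delta> + x))) = x" for x using d4 by (metis add.assoc add_0)
    obtain b B' where B: "B = add_mset b B'" using False by (cases B) auto
    have difb: "pair_diff b = \<delta> \<or> pair_diff b = - \<delta>" using diff_P(1)[of "(a, a + \<delta>)" b] by (simp add: P B)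
    have d3: "\<delta> + \<delta> + \<delta> \<noteq> 0" using d4 dz by auto
    have neg: "- \<delta> = \<delta> + \<delta> + \<delta>" using d4 by (simp add: neg_eq_iff_add_eq_0 add.assoc)
    \<comment> \<open>With a further pair \<open>e = - \<delta> - \<delta>\<close>, so
      \<open>\<delta>\<close> has order 4. All differences lie in the group it generates, which
      bounds \<open>m\<close> by 3; the lengthwise pairing is then seen to have four sums.\<close>
    let ?N = "{0, \<delta>, \<delta> + \<delta>, \<delta> + \<delta> + \<delta>}"
    have "is_subgroup ?N"
      unfolding is_subgroup_def using d4 d4'[of 0] by (auto simp: neg add.assoc d4')
    moreover have "pair_diff r \<in> ?N" if "r \<in># P" for r
      using diff_P(1)[of "(a, a + \<delta>)" r] that neg by (auto simp: P)
    ultimately have "card (psum P) \<le> card ?N" by (intro card_psum_le_subgroup) auto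
    also have "\<dots> \<le> 4" by (simp add: card_insert_if)
    finally have "m \<le> 3" using card_P by simp
    moreover have "size P = size B' + 3" by (simp add: P B)
    ultimately have B': "B' = {#}" and m3: "m = 3" using size_P by auto
    define t where "t = fst b + a + a + \<delta>"
    have "{t, t + e, t + pair_diff b, t + e + pair_diff b} \<subseteq> psum ?P2"
      by (auto simp: B B' t_def c pair_diff_def algebra_simps)
    then have "card {t, t + e, t + pair_diff b, t + e + pair_diff b} \<le> card (psum ?P2)"
      by (rule card_mono[OF finite_psum])
    moreover have "card {t, t + e, t + pair_diff b, t + e + pair_diff b} = 4"
    proof -
      have "pair_diff b \<noteq> 0" using difb dz by auto
      moreover have "e \<noteq> pair_diff b" using difb d3 dz ed by (auto simp: algebra_simps)
      moreover have "e + pair_diff b \<noteq> 0" using difb dz d3 ed by (auto simp: algebra_simps)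
      ultimately show ?thesis using ez by (simp add: add.assoc)
    qed
    ultimately show False using two m3 by simp
  qed
qed

lemma pairs_meet:
  assumes "p \<in># P" "q \<in># P"
  shows "fst p = fst q \<or> fst p = snd q \<or> snd p = fst q \<or> snd p = snd q"
proof (rule ccontr)
  assume ne: "\<not> ?thesis"
  then have "p \<noteq> q" by auto
  then obtain B where P: "P = add_mset p (add_mset q B)"
    using assms by (metis insert_DiffM insert_noteq_member)
  have p: "p = (fst p, fst p + pair_diff p)" by (simp add: pair_diff_def)
  have P': "P = add_mset (fst p, fst p + pair_diff p) (add_mset q B)" using P p by simp
  have pp: "fst p + pair_diff p = snd p" by (simp add: pair_diff_def)
  from diff_P(1)[OF assms] show False
  proof
    assume "pair_diff q = pair_diff p"
    then have qq: "fst q + pair_diff p = snd q" by (simp add: pair_diff_def algebra_simps)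
    show False
    proof (rule no_parallel_pairs[OF P', of "fst q"])
      show "q = (fst q, fst q + pair_diff p) \<or> q = (fst q + pair_diff p, fst q)" by (simp add: qq)
    qed (use ne in \<open>auto simp: pp qq\<close>)
  next
    assume "pair_diff q = - pair_diff p"
    then have qq: "snd q + pair_diff p = fst q" by (simp add: pair_diff_def algebra_simps)
    show False
    proof (rule no_parallel_pairs[OF P', of "snd q"])
      show "q = (snd q, snd q + pair_diff p) \<or> q = (snd q + pair_diff p, snd q)" by (simp add: qq)
    qed (use ne in \<open>auto simp: pp qq\<close>)
  qed
qed

text \<open>Replacing the other end of \<open>p\<close> by \<open>c\<close> gives a pair to which
  \<open>replace_one\<close> applies, unless \<open>c\<close> equals the end that is kept.\<close>

lemma rest_near:
  assumes p: "p \<in># P" and c: "c \<in># S - terms P" and d: "d = pair_diff p \<or> d = - pair_diff p"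
  shows "c = fst p \<or> c = fst p + d \<or> c = fst p - d"
    and "c = snd p \<or> c = snd p + d \<or> c = snd p - d"
proof -
  obtain B where P: "P = add_mset p B" using p by (metis insert_DiffM)
  have sub: "add_mset c (terms P) \<subseteq># S" by (rule add_mset_subset_of_diff[OF terms_P c])
  have near: "c = u \<or> c = u + d \<or> c = u - d"
    if u: "add_mset u (add_mset c (terms B)) \<subseteq># add_mset c (terms P)" for u
  proof (cases "u = c")
    case False
    have "pairing S m (add_mset (u, c) B)"
      using pairing False subset_mset.order_trans[OF u sub] by (auto simp: pairing_def P)
    from replace_one[OF P this] show ?thesis using d by (auto simp: algebra_simps)
  qed simp
  show "c = fst p \<or> c = fst p + d \<or> c = fst p - d"
    by (rule near) (simp add: P subseteq_mset_def)
  show "c = snd p \<or> c = snd p + d \<or> c = snd p - d"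
    by (rule near) (simp add: P subseteq_mset_def)
qed

text \<open>The term is within one step of both ends. A term beyond an end would be two steps from
  the other, which is a single step only if the difference has order dividing 3.\<close>

lemma rest_in_pair:
  assumes p: "p \<in># P" and c: "c \<in># S - terms P" and d3: "pair_diff p + pair_diff p + pair_diff p \<noteq> 0"
  shows "c = fst p \<or> c = snd p"
proof -
  have d2: "pair_diff p + pair_diff p \<noteq> 0" and d1: "pair_diff p \<noteq> 0" using diff_P(2)[OF p p] diff_nz[OF p] by auto
  have s: "snd p = fst p + pair_diff p" by (simp add: pair_diff_def)
  have "c = fst p \<or> c = fst p + pair_diff p \<or> c = fst p - pair_diff p"
    and "c = snd p \<or> c = snd p + pair_diff p \<or> c = snd p - pair_diff p"
    using rest_near[OF p c, of "pair_diff p"] by simp_all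
  moreover have "fst p - pair_diff p \<noteq> fst p + pair_diff p" "fst p - pair_diff p \<noteq> fst p + pair_diff p + pair_diff p"
    "fst p - pair_diff p \<noteq> fst p"
    using d1 d2 d3 by (auto simp: diff_eq_eq add.assoc)
  ultimately show ?thesis unfolding s by auto
qed

text \<open>If \<open>3d = 0\<close>, everything lies in one coset of a group of order 3. Otherwise
  the pairs are steps \<open>\<plusminus>d\<close> that pairwise intersect, so they all equal one
  pair or all share a centre \<open>x\<close>.\<close>

lemma supp_structure:
  "(m = 2 \<and> (\<exists>x d. d + d \<noteq> 0 \<and> d + d + d = 0 \<and> set_mset S = {x, x + d, x + d + d})) \<or>
   card (set_mset S) \<le> 2 \<or>
   (\<exists>x d. set_mset S \<subseteq> {x - d, x, x + d} \<and> count S x = size S - m)"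
proof -
  have "P \<noteq> {#}" using size_P m2 by auto
  then obtain p0 where p0: "p0 \<in># P" by blast
  define a d where "a = fst p0" and "d = pair_diff p0"
  have b: "snd p0 = a + d" by (simp add: a_def d_def pair_diff_def)
  have d1: "d \<noteq> 0" and d2: "d + d \<noteq> 0" using diff_nz[OF p0] diff_P(2)[OF p0 p0] by (simp_all add: d_def)
  have pair_diff: "snd p = fst p + d \<or> fst p = snd p + d" if "p \<in># P" for p
    using diff_P(1)[OF p0 that] unfolding d_def[symmetric] by (auto simp: pair_diff_def algebra_simps)
  have meet: "fst p = a \<or> fst p = a + d \<or> snd p = a \<or> snd p = a + d" if "p \<in># P" for p
    using pairs_meet[OF that p0] b by (auto simp: a_def)
  have inS: "y \<in># S - terms P \<or> (\<exists>p\<in>#P. y = fst p \<or> y = snd p)" if "y \<in># S" for y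
  proof (cases "y \<in># terms P")
    case True
    then show ?thesis by (auto simp: terms_def)
  next
    case False
    then show ?thesis using that by (simp add: in_diff_count not_in_iff)
  qed
  show ?thesis
  proof (cases "d + d + d = 0")
    case True
    then have nd: "- d = d + d" by (simp add: neg_eq_iff_add_eq_0 add.assoc)
    have min: "u - d = u + d + d" for u using nd by (metis add.assoc diff_conv_add_uminus)
    have d3': "u + d + d + d = u" for u using True by (simp add: add.assoc)
    have up: "y + d \<in> {a, a + d, a + d + d}" if "y \<in> {a, a + d, a + d + d}" for y
      using that d3'[of a] by auto
    have down: "y \<in> {a, a + d, a + d + d}" if "y + d \<in> {a, a + d, a + d + d}" for y
    proof -
      have "y = a - d \<or> y = a \<or> y = a + d" using that by (auto simp: eq_diff_eq)
      then show ?thesis using min[of a] by auto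
    qed
    have sub: "set_mset S \<subseteq> {a, a + d, a + d + d}"
    proof
      fix y assume "y \<in> set_mset S"
      then consider "y \<in># S - terms P" | p where "p \<in># P" "y = fst p \<or> y = snd p" using inS by blast
      then show "y \<in> {a, a + d, a + d + d}"
      proof cases
        case 1
        then show ?thesis using rest_near(1)[OF p0 1, of d] min by (auto simp: a_def d_def)
      next
        case 2
        have "fst p \<in> {a, a + d, a + d + d} \<or> snd p \<in> {a, a + d, a + d + d}"
          using meet[OF 2(1)] by blast
        then have "fst p \<in> {a, a + d, a + d + d} \<and> snd p \<in> {a, a + d, a + d + d}"
          using pair_diff[OF 2(1)] up down by metis
        then show ?thesis using 2(2) by metis
      qed
    qed
    show ?thesis
    proof (cases "set_mset S = {a, a + d, a + d + d}")
      case eq: True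
      \<comment> \<open>All differences lie in a group of order 3, so \<open>m + 1\<close> is at
        most 3.\<close>
      have "card (psum P) \<le> card {0, d, d + d}"
      proof (rule card_psum_le_subgroup)
        show "is_subgroup {0, d, d + d}"
          unfolding is_subgroup_def using True by (auto simp: nd add.assoc)
        fix q assume "q \<in># P"
        then show "pair_diff q \<in> {0, d, d + d}"
          using diff_P(1)[OF p0] nd unfolding d_def[symmetric] by auto
      qed simp
      also have "\<dots> \<le> 3" by (simp add: card_insert_if)
      finally have "m = 2" using card_P m2 by simp
      then show ?thesis using True d2 eq by blast
    next
      case False
      then have "set_mset S \<subset> {a, a + d, a + d + d}" using sub by blast
      from psubset_card_mono[OF _ this] have "card (set_mset S) < 3"
        by (auto simp: card_insert_if split: if_splits)
      then show ?thesis by simp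
    qed
  next
    case d3: False
    have d3': "pair_diff p + pair_diff p + pair_diff p \<noteq> 0" if "p \<in># P" for p
    proof -
      have "pair_diff p = d \<or> pair_diff p = - d" using diff_P(1)[OF p0 that] by (simp add: d_def)
      moreover have "- d + - d + - d = - (d + d + d)" by (simp add: algebra_simps)
      ultimately show ?thesis using d3 by (metis neg_equal_0_iff_equal)
    qed
    show ?thesis
    proof (cases "\<forall>p\<in>#P. {fst p, snd p} = {a, a + d}")
      case True
      have "set_mset S \<subseteq> {a, a + d}"
      proof
        fix y assume "y \<in> set_mset S"
        then consider "y \<in># S - terms P" | p where "p \<in># P" "y = fst p \<or> y = snd p" using inS by blast
        then show "y \<in> {a, a + d}"
        proof cases
          case 1
          then show ?thesis using rest_in_pair[OF p0 1 d3'[OF p0]] b by (auto simp: a_def)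
        next
          case 2
          then show ?thesis using True by blast
        qed
      qed
      from card_mono[OF _ this] have "card (set_mset S) \<le> card {a, a + d}" by simp
      also have "\<dots> \<le> 2" by (simp add: card_insert_if)
      finally show ?thesis by blast
    next
      case False
      then obtain p1 where p1: "p1 \<in># P" "{fst p1, snd p1} \<noteq> {a, a + d}" by blast
      \<comment> \<open>The pair \<open>p1\<close> meets \<open>p0\<close> without equalling it, so
        it continues \<open>p0\<close> by one step at one end; the sign of \<open>\<delta>\<close>
        is chosen so that this end is \<open>x\<close>.\<close>
      have "\<exists>x \<delta>. (\<delta> = d \<or> \<delta> = - d) \<and> {fst p0, snd p0} = {x, x + \<delta>} \<and> {fst p1, snd p1} = {x, x - \<delta>}"
      proof -
        have "\<exists>u. {fst p1, snd p1} = {u, u + d}" using pair_diff[OF p1(1)] by (metis insert_commute)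
        then obtain u where u: "{fst p1, snd p1} = {u, u + d}" ..
        then have "u = a \<or> u = a + d \<or> u + d = a" using meet[OF p1(1)] by (auto simp: doubleton_eq_iff)
        moreover have "u \<noteq> a" using u p1(2) by auto
        ultimately consider "u = a + d" | "a = u + d" by auto
        then show ?thesis
        proof cases
          case 1
          show ?thesis
            by (rule exI[of _ "a + d"], rule exI[of _ "- d"]) (use u b 1 in \<open>auto simp: a_def\<close>)
        next
          case 2
          show ?thesis
            by (rule exI[of _ a], rule exI[of _ d]) (use u b 2 in \<open>auto simp: a_def\<close>)
        qed
      qed
      then obtain x \<delta> where x: "\<delta> = d \<or> \<delta> = - d" "{fst p0, snd p0} = {x, x + \<delta>}"
        "{fst p1, snd p1} = {x, x - \<delta>}" by blast
      have e1: "\<delta> \<noteq> 0" using x(1) d1 by auto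
      have e2: "\<delta> + \<delta> \<noteq> 0" using x(1) d2 by (metis minus_add_distrib neg_equal_0_iff_equal)
      have e3: "\<delta> + \<delta> + \<delta> \<noteq> 0" using x(1) d3 by (metis minus_add_distrib neg_equal_0_iff_equal)
      have difx: "snd p = fst p + \<delta> \<or> fst p = snd p + \<delta>" if "p \<in># P" for p
        using pair_diff[OF that] x(1) by (auto simp: algebra_simps)
      \<comment> \<open>A pair avoiding \<open>x\<close> could meet both \<open>p0\<close> and
        \<open>p1\<close> only by joining \<open>x + \<delta>\<close> to
        \<open>x - \<delta>\<close>, a double step, which is not a single step since
        \<open>3 \<delta>\<close> is nonzero.\<close>
      have contains: "(fst p = x \<and> (snd p = x + \<delta> \<or> snd p = x - \<delta>)) \<or>
        (snd p = x \<and> (fst p = x + \<delta> \<or> fst p = x - \<delta>))" if "p \<in># P" for p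
      proof -
        have "{fst p, snd p} \<inter> {x, x + \<delta>} \<noteq> {}" "{fst p, snd p} \<inter> {x, x - \<delta>} \<noteq> {}"
          using pairs_meet[OF that p0] pairs_meet[OF that p1(1)] unfolding x(2,3)[symmetric] by auto
        then have 1: "fst p = x \<or> fst p = x + \<delta> \<or> snd p = x \<or> snd p = x + \<delta>"
          and 2: "fst p = x \<or> fst p = x - \<delta> \<or> snd p = x \<or> snd p = x - \<delta>" by auto
        have "x + \<delta> \<noteq> x - \<delta>" using e2 by (simp add: eq_diff_eq add.assoc)
        then have "fst p = x \<or> snd p = x \<or> (fst p = x + \<delta> \<and> snd p = x - \<delta>) \<or>
          (snd p = x + \<delta> \<and> fst p = x - \<delta>)" using 1 2 by metis
        moreover have "x + \<delta> \<noteq> x - \<delta> + \<delta>" using e1 by simp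
        moreover have "x - \<delta> \<noteq> x + \<delta> + \<delta>" using e3 by (simp add: diff_eq_eq add.assoc)
        ultimately have "fst p = x \<or> snd p = x" using difx[OF that] by metis
        then show ?thesis using difx[OF that] by (auto simp: algebra_simps)
      qed
      have rest: "c = x" if c: "c \<in># S - terms P" for c
      proof -
        have "c \<in> {x, x + \<delta>}" "c \<in> {x, x - \<delta>}"
          using rest_in_pair[OF p0 c d3'[OF p0]] rest_in_pair[OF p1(1) c d3'[OF p1(1)]]
          unfolding x(2,3)[symmetric] by auto
        moreover have "x + \<delta> \<noteq> x - \<delta>" using e2 by (simp add: eq_diff_eq add.assoc)
        ultimately show ?thesis by auto
      qed
      have "set_mset S \<subseteq> {x - \<delta>, x, x + \<delta>}"
        using inS rest contains by blast
      moreover have "count S x = size S - m"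
      proof -
        have "count (terms P) x = m"
          using count_terms_one_each[of P x] contains e1 size_P by fastforce
        moreover have "count (S - terms P) x = size (S - terms P)"
          using rest by (metis count_replicate_mset set_mset_subset_singletonD singleton_iff size_replicate_mset subsetI)
        moreover have "count S x = count (terms P) x + count (S - terms P) x"
          using terms_P by (metis count_union subset_mset.add_diff_inverse)
        moreover have "size (S - terms P) = size S - 2 * m" "2 * m \<le> size S"
          using terms_P size_P size_mset_mono[OF terms_P] by (simp_all add: size_Diff_submset)
        ultimately show ?thesis by linarith
      qed
      ultimately show ?thesis by (intro disjI2 exI conjI)
    qed
  qed
qed

end

section \<open>Setpartitions\<close>

lemma ex_submset_size: "k \<le> size M \<Longrightarrow> \<exists>U. U \<subseteq># M \<and> size U = k"
proof (induction k)
  case (Suc k)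
  then obtain U where U: "U \<subseteq># M" "size U = k" by auto
  then have "size (M - U) \<noteq> 0" using Suc.prems by (simp add: size_Diff_submset del: size_eq_0_iff_empty)
  then obtain c where "c \<in># M - U" by fastforce
  then show ?case using add_mset_subset_of_diff[OF U(1)] U(2) by (intro exI[of _ "add_mset c U"]) auto
qed auto

lemma sumset_insert:
  "finite I \<Longrightarrow> i \<notin> I \<Longrightarrow> sumset A (insert i I) = {a + s | a s. a \<in> A i \<and> s \<in> sumset A I}"
proof (intro set_eqI iffI)
  fix y assume fin: "finite I" "i \<notin> I" and "y \<in> sumset A (insert i I)"
  then obtain a where "y = (\<Sum>j\<in>insert i I. a j)" "\<forall>j\<in>insert i I. a j \<in> A j"
    by (auto simp: sumset_def)
  then show "y \<in> {a + s | a s. a \<in> A i \<and> s \<in> sumset A I}"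
    using fin by (auto simp: sumset_def)
next
  fix y assume fin: "finite I" "i \<notin> I" and "y \<in> {a + s | a s. a \<in> A i \<and> s \<in> sumset A I}"
  then obtain a0 a where a: "y = a0 + (\<Sum>j\<in>I. a j)" "a0 \<in> A i" "\<forall>j\<in>I. a j \<in> A j"
    by (auto simp: sumset_def)
  have "(\<Sum>j\<in>I. (a(i := a0)) j) = (\<Sum>j\<in>I. a j)" using fin by (intro sum.cong) auto
  then have "y = (\<Sum>j\<in>insert i I. (a(i := a0)) j)" using fin a by simp
  moreover have "\<forall>j\<in>insert i I. (a(i := a0)) j \<in> A j" using a by auto
  ultimately show "y \<in> sumset A (insert i I)" unfolding sumset_def by blast
qed

lemma sumset_eq_psum:
  "finite I \<Longrightarrow> sumset (\<lambda>i. {fst (f i), snd (f i)}) I = psum (image_mset f (mset_set I))"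
proof (induction I rule: finite_induct)
  case empty
  then show ?case by (simp add: sumset_def)
next
  case (insert i I)
  have "sumset (\<lambda>i. {fst (f i), snd (f i)}) (insert i I) =
    {a + s | a s. a \<in> {fst (f i), snd (f i)} \<and> s \<in> psum (image_mset f (mset_set I))}"
    using insert by (simp add: sumset_insert)
  also have "\<dots> = psum (add_mset (f i) (image_mset f (mset_set I)))"
    unfolding psum_add_mset_image by auto
  finally show ?case using insert by simp
qed

text \<open>A degenerate pair \<open>(c, c)\<close> stands for the singleton \<open>{c}\<close>, so
  that a setpartition mixing pairs and singletons is again handled by \<open>psum\<close>.\<close>

lemma psum_add_singletons:
  "psum (P + image_mset (\<lambda>c. (c, c)) U) = (+) (sum_mset U) ` psum P"
  by (induction U) (auto simp: psum_add_mset_image image_image add.assoc)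

lemma ex_enumeration:
  assumes "size M = n"
  shows "\<exists>f. image_mset f (mset_set {1..n}) = M"
proof -
  obtain xs where xs: "mset xs = M" using ex_mset by blast
  have len: "length xs = n" using xs assms by auto
  have "map (\<lambda>i. xs ! (i - 1)) [1..<Suc n] = xs"
    by (rule nth_equalityI) (auto simp: len simp del: upt_Suc)
  moreover have "mset (map (\<lambda>i. xs ! (i - 1)) [1..<Suc n]) = image_mset (\<lambda>i. xs ! (i - 1)) (mset_set {1..n})"
    by (simp add: atLeastLessThanSuc_atLeastAtMost del: upt_Suc)
  ultimately show ?thesis using xs by metis
qed

lemma sum_mset_pairs:
  "\<forall>p\<in>#P. fst p \<noteq> snd p \<Longrightarrow> (\<Sum>p\<in>#P. mset_set {fst p, snd p}) = terms P"
  by (induction P) (auto simp: ac_simps)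

lemma setpartition_of_pairing:
  fixes S :: "'a::ab_group_add multiset"
  assumes pairing: "pairing S m P" and mn: "m \<le> n" and szS: "n + m \<le> size S"
    and j: "P = add_mset j B" "pair_diff j \<in> stab (psum B)"
    and meets: "\<forall>p\<in>#P. fst p - x \<in> stab (psum P) \<or> snd p - x \<in> stab (psum P)"
    and rest: "\<forall>c\<in>#S - terms P. c - x \<in> stab (psum P)"
  shows "stab (SigmaN n S) \<noteq> {0} \<and> (\<exists>x A. setpartition A n \<and> seqOf A n \<subseteq># S \<and>
    size (seqOf A n) = n + m \<and> sumset A {1..n} = SigmaN n S \<and>
    set_mset (S - seqOf A n) \<subseteq> (\<lambda>h. x + h) ` stab (SigmaN n S) \<and>
    (\<forall>i\<in>{1..n}. card (A i) \<le> 2 \<and> ((\<lambda>h. x + h) ` stab (SigmaN n S)) \<inter> A i \<noteq> {}) \<and>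
    (\<exists>j\<in>{1..n}. card (sumset A {1..n}) = card (sumset A ({1..n} - {j}))))"
proof -
  have terms: "terms P \<subseteq># S" and szP: "size P = m" and ne: "\<forall>p\<in>#P. fst p \<noteq> snd p"
    using pairing by (auto simp: pairing_def)
  have "size (S - terms P) = size S - 2 * m" using terms szP by (simp add: size_Diff_submset)
  then have "n - m \<le> size (S - terms P)" using szS mn by simp
  then obtain U where U: "U \<subseteq># S - terms P" "size U = n - m" using ex_submset_size by blast
  have Sig: "SigmaN n S = (+) (sum_mset U) ` psum P"
    by (rule SigmaN_eq_psum[OF terms U(1) _ meets rest]) (use U szP mn in simp)
  have H: "stab (SigmaN n S) = stab (psum P)" by (simp add: Sig)
  let ?M = "P + image_mset (\<lambda>c. (c, c)) U"
  have "size ?M = n" using szP U mn by simp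
  then obtain f where f: "image_mset f (mset_set {1..n}) = ?M" using ex_enumeration by blast
  define A where "A = (\<lambda>i. {fst (f i), snd (f i)})"
  have fM: "f i \<in># ?M" if "i \<in> {1..n}" for i
  proof -
    have "f i \<in># image_mset f (mset_set {1..n})" using that by auto
    then show ?thesis using f by (simp only:)
  qed
  have sumA: "sumset A I = psum (image_mset f (mset_set I))" if "finite I" for I
    unfolding A_def by (rule sumset_eq_psum[OF that])
  have "seqOf A n = (\<Sum>p\<in>#image_mset f (mset_set {1..n}). mset_set {fst p, snd p})"
    by (simp add: seqOf_def A_def sum_unfold_sum_mset multiset.map_comp comp_def)
  also have "\<dots> = terms P + U"
    unfolding f using sum_mset_pairs[OF ne] by (simp add: multiset.map_comp comp_def)
  finally have seq: "seqOf A n = terms P + U" .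
  have sumAn: "sumset A {1..n} = SigmaN n S"
    using sumA[of "{1..n}"] f psum_add_singletons[of P U] Sig by simp
  have "j \<in># image_mset f (mset_set {1..n})" unfolding f j(1) by simp
  then obtain i where i: "i \<in> {1..n}" "f i = j" by auto
  have "image_mset f (mset_set {1..n}) = add_mset j (image_mset f (mset_set ({1..n} - {i})))"
    using i by (subst mset_set.remove[of _ i]) auto
  then have "image_mset f (mset_set ({1..n} - {i})) = B + image_mset (\<lambda>c. (c, c)) U"
    using f j(1) by simp
  then have "sumset A ({1..n} - {i}) = (+) (sum_mset U) ` psum B"
    using sumA[of "{1..n} - {i}"] psum_add_singletons[of B U] by simp
  then have cardj: "card (sumset A {1..n}) = card (sumset A ({1..n} - {i}))"
    unfolding sumAn Sig using psum_add_stab[OF j(2)] j(1) by simp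
  have "pair_diff j \<in> stab (psum P)" using j stab_psum_add by blast
  moreover have "pair_diff j \<noteq> 0" using ne j(1) by (auto simp: pair_diff_def)
  ultimately have "stab (SigmaN n S) \<noteq> {0}" unfolding H by auto
  moreover have "setpartition A n" by (simp add: setpartition_def A_def)
  moreover have "seqOf A n \<subseteq># S"
    unfolding seq using terms U(1) by (metis subset_mset.add_left_mono subset_mset.add_diff_inverse)
  moreover have "size (seqOf A n) = n + m" using seq szP U mn by simp
  moreover have "set_mset (S - seqOf A n) \<subseteq> (\<lambda>h. x + h) ` stab (SigmaN n S)"
  proof
    fix c assume "c \<in># S - seqOf A n"
    then have "c \<in># S - terms P" unfolding seq diff_diff_add_mset[symmetric] by (rule in_diffD)
    then show "c \<in> (\<lambda>h. x + h) ` stab (SigmaN n S)" unfolding H mem_image_plus using rest by blast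
  qed
  moreover have "card (A i) \<le> 2 \<and> ((\<lambda>h. x + h) ` stab (SigmaN n S)) \<inter> A i \<noteq> {}" if "i \<in> {1..n}" for i
  proof
    show "card (A i) \<le> 2" by (simp add: A_def card_insert_if)
    have "fst (f i) - x \<in> stab (psum P) \<or> snd (f i) - x \<in> stab (psum P)"
      using fM[OF that] meets rest mset_subset_eqD[OF U(1)] by auto
    then have "fst (f i) \<in> (\<lambda>h. x + h) ` stab (psum P) \<or> snd (f i) \<in> (\<lambda>h. x + h) ` stab (psum P)"
      unfolding mem_image_plus .
    then show "((\<lambda>h. x + h) ` stab (SigmaN n S)) \<inter> A i \<noteq> {}" unfolding H A_def by blast
  qed
  ultimately show ?thesis using sumAn cardj i(1) by blast
qed

section \<open>The theorem\<close>

lemma UNIV_2: "(UNIV :: 2 set) = {0, 1}"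
  by (rule card_subset_eq[symmetric]) auto

lemma UNIV_3: "(UNIV :: 3 set) = {0, 1, 2}"
  by (rule card_subset_eq[symmetric]) auto

lemma all_2: "(\<forall>a :: 2. Q a) \<longleftrightarrow> Q 0 \<and> Q 1"
  using UNIV_2 by (metis UNIV_I insertE singletonD)

lemma all_3: "(\<forall>a :: 3. Q a) \<longleftrightarrow> Q 0 \<and> Q 1 \<and> Q 2"
  using UNIV_3 by (metis UNIV_I insertE singletonD)

lemma coset_order_3:
  fixes d :: "'a::ab_group_add"
  assumes d2: "d + d \<noteq> 0" and d3: "d + d + d = 0"
  shows "\<exists>K x' (f :: 3 \<Rightarrow> 'a). is_subgroup K \<and> group_iso_onto f K \<and>
    {x, x + d, x + d + d} = (\<lambda>k. x' + k) ` K"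
proof -
  let ?K = "{0, d, d + d}"
  define f :: "3 \<Rightarrow> 'a" where "f i = (if i = 0 then 0 else if i = 1 then d else d + d)" for i
  have nz: "d \<noteq> 0" "d + d \<noteq> d" using d2 by auto
  have nd: "- d = d + d" using d3 by (simp add: neg_eq_iff_add_eq_0 add.assoc)
  have d3': "d + (d + d) = 0" "d + (d + (d + y)) = y" for y
    using d3 by (metis add.assoc add_0)+
  have sub: "is_subgroup ?K" unfolding is_subgroup_def by (auto simp: nd add.assoc d3')
  have f: "f 0 = 0" "f 1 = d" "f 2 = d + d" by (simp_all add: f_def)
  \<comment> \<open>The values \<open>1 + 2\<close> and \<open>2 + 2\<close> arise when additivity
    is checked entry by entry.\<close>
  have num: "(3 :: 3) = 0" "(4 :: 3) = 1" by simp_all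
  have "inj f" unfolding inj_def all_3 using nz d2 by (simp add: f)
  moreover have "range f = ?K" unfolding UNIV_3 by (auto simp: f)
  ultimately have "bij_betw f UNIV ?K" by (simp add: bij_betw_def)
  moreover have "\<forall>a b. f (a + b) = f a + f b" unfolding all_3 by (simp add: f num d3' add.assoc)
  ultimately have "group_iso_onto f ?K" by (simp add: group_iso_onto_def)
  moreover have "{x, x + d, x + d + d} = (\<lambda>k. x + k) ` ?K" by (auto simp: add.assoc)
  ultimately show ?thesis using sub by blast
qed

lemma coset_klein_four:
  fixes g y :: "'a::ab_group_add"
  assumes nz: "g \<noteq> 0" "y \<noteq> 0" "y \<noteq> g" and gg: "g + g = 0" and yy: "y + y = 0"
  shows "\<exists>K x' (f :: 2 \<times> 2 \<Rightarrow> 'a). is_subgroup K \<and> group_iso_onto f K \<and>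
    {x, x + g, x + y, x + y + g} = (\<lambda>k. x' + k) ` K"
proof -
  let ?K = "{0, g, y, y + g}"
  define f :: "2 \<times> 2 \<Rightarrow> 'a" where "f p = (if fst p = 0 then 0 else y) + (if snd p = 0 then 0 else g)" for p
  have neg: "- g = g" "- y = y" using gg yy by (simp_all add: neg_eq_iff_add_eq_0)
  have gg': "g + (g + u) = u" and yy': "y + (y + u) = u" for u
    using gg yy by (metis add.assoc add_0)+
  have gy: "g + y = y + g" "g + (y + u) = y + (g + u)" for u by (simp_all add: add.commute add.left_commute)
  have yg: "y + g \<noteq> 0" using nz neg by (metis add_eq_0_iff)
  have sub: "is_subgroup ?K"
    unfolding is_subgroup_def by (auto simp: neg add.assoc gg yy gg' yy' gy)
  have f: "f (0, 0) = 0" "f (0, 1) = g" "f (1, 0) = y" "f (1, 1) = y + g" by (simp_all add: f_def)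
  have all: "(\<forall>p :: 2 \<times> 2. Q p) \<longleftrightarrow> Q (0, 0) \<and> Q (0, 1) \<and> Q (1, 0) \<and> Q (1, 1)" for Q
    by (simp add: split_paired_All all_2 conj_assoc)
  have num: "(2 :: 2) = 0" by simp
  have "inj f" unfolding inj_def all using nz yg by (auto simp: f)
  moreover have "range f = ?K"
  proof -
    have U: "(UNIV :: (2 \<times> 2) set) = {(0, 0), (0, 1), (1, 0), (1, 1)}"
      unfolding UNIV_Times_UNIV[symmetric] UNIV_2 by auto
    show ?thesis unfolding U by (auto simp: f)
  qed
  ultimately have "bij_betw f UNIV ?K" by (simp add: bij_betw_def)
  moreover have "\<forall>a b. f (a + b) = f a + f b" unfolding all by (simp add: f num add.assoc gg yy gg' yy' gy)
  ultimately have "group_iso_onto f ?K" by (simp add: group_iso_onto_def)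
  moreover have "{x, x + g, x + y, x + y + g} = (\<lambda>k. x + k) ` ?K" by (auto simp: add.assoc)
  ultimately show ?thesis using sub by blast
qed

text \<open>If at least two terms are left out, fix \<open>n - 1\<close> terms and add one of
  \<open>u\<close>, \<open>v\<close>, \<open>w\<close>; if exactly one is left out, let it be
  \<open>u\<close>, \<open>v\<close> or \<open>w\<close>. The injective map \<open>h\<close> is the
  identity in the first case and negation in the second.\<close>

lemma card_SigmaN_ge_3:
  fixes S :: "'a::ab_group_add multiset"
  assumes n: "1 \<le> n" "n < size S" and S: "u \<in># S" "v \<in># S" "w \<in># S"
    and dist: "u \<noteq> v" "u \<noteq> w" "v \<noteq> w"
  shows "3 \<le> card (SigmaN n S)"
proof -
  have "\<exists>c h. inj h \<and> {c + h u, c + h v, c + h w} \<subseteq> SigmaN n S"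
  proof (cases "n + 2 \<le> size S")
    case True
    obtain S' where S': "S = add_mset u (add_mset v (add_mset w S'))"
      using S dist by (metis insert_DiffM insert_noteq_member)
    then have "n - 1 \<le> size S'" using True by simp
    then obtain U where U: "U \<subseteq># S'" "size U = n - 1" using ex_submset_size by blast
    have "sum_mset U + t \<in> SigmaN n S" if "add_mset t U \<subseteq># S" for t
      unfolding SigmaN_def using that U n by (auto intro!: exI[of _ "add_mset t U"] simp: add.commute)
    moreover have "add_mset u U \<subseteq># S" "add_mset v U \<subseteq># S" "add_mset w U \<subseteq># S"
      using U(1) dist unfolding S' by (auto simp: subseteq_mset_def le_SucI)
    ultimately have "{sum_mset U + id u, sum_mset U + id v, sum_mset U + id w} \<subseteq> SigmaN n S" by simp
    then show ?thesis using inj_on_id by blast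
  next
    case False
    then have sz: "size S = Suc n" using n by simp
    have "sum_mset S + - t \<in> SigmaN n S" if "t \<in># S" for t
    proof -
      obtain T where "S = add_mset t T" using \<open>t \<in># S\<close> by (metis insert_DiffM)
      then show ?thesis unfolding SigmaN_def using sz by (auto intro!: exI[of _ T])
    qed
    then have "{sum_mset S + - u, sum_mset S + - v, sum_mset S + - w} \<subseteq> SigmaN n S" using S by simp
    moreover have "inj (uminus :: 'a \<Rightarrow> 'a)" by (simp add: inj_def)
    ultimately show ?thesis by blast
  qed
  then obtain c h where ch: "inj h" "{c + h u, c + h v, c + h w} \<subseteq> SigmaN n S" by blast
  have "card {c + h u, c + h v, c + h w} = 3" using ch(1) dist by (simp add: inj_eq)
  then show ?thesis using card_mono[OF finite_SigmaN ch(2)] by simp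
qed

text \<open>The translation \<open>t\<close> depends only on the terms, not on how they are paired.
  Hence if one pairing exhausts the subsequence sums, every re-pairing of the same terms has its
  sums among them.\<close>

lemma ex_translate_subset_SigmaN:
  assumes "pairing S m P" "m \<le> n" "n + m \<le> size S"
  shows "\<exists>t. \<forall>P'. terms P' = terms P \<longrightarrow> (+) t ` psum P' \<subseteq> SigmaN n S"
proof -
  have terms: "terms P \<subseteq># S" and szP: "size P = m" using assms(1) by (auto simp: pairing_def)
  have "size (S - terms P) = size S - 2 * m" using terms szP by (simp add: size_Diff_submset)
  then have "n - m \<le> size (S - terms P)" using assms by simp
  then obtain U where U: "U \<subseteq># S - terms P" "size U = n - m" using ex_submset_size by blast
  have sub: "terms P + U \<subseteq># S" using terms U(1) by (metis subset_mset.add_left_mono subset_mset.add_diff_inverse)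
  have "(+) (sum_mset U) ` psum P' \<subseteq> SigmaN n S" if "terms P' = terms P" for P'
  proof (rule psum_subset_SigmaN)
    show "terms P' + U \<subseteq># S" using sub that by simp
    have "size P' = size P" using that size_terms[of P'] size_terms[of P] by simp
    then show "size P' + size U = n" using U(2) szP assms(2) by simp
  qed
  then show ?thesis by blast
qed

theorem theorem3p3:
  fixes S :: "('a::ab_group_add) multiset" and n :: nat
  assumes "n \<ge> 1" and "size S > n"
    and "card (SigmaN n S) \<le> min n (min (size S - n) (size S - hS S)) + 1"
  shows "let m = min n (min (size S - n) (size S - hS S)) in
    (((n = 2 \<and> size S = card (set_mset S) \<and>
        (\<exists>K x (f :: 2 \<times> 2 \<Rightarrow> 'a). is_subgroup K \<and> group_iso_onto f K \<and>
            set_mset S = (\<lambda>k. x + k) ` K))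
      \<or> (m = 2 \<and> (\<exists>K x (f :: 3 \<Rightarrow> 'a). is_subgroup K \<and> group_iso_onto f K \<and>
            set_mset S = (\<lambda>k. x + k) ` K))
      \<or> card (set_mset S) \<le> 2
      \<or> (\<exists>x d. set_mset S \<subseteq> {x - d, x, x + d} \<and> count S x = hS S \<and> hS S \<ge> size S - m))
     \<and> (card (SigmaN n S) = m + 1 \<or> card (set_mset S) = 1))
    \<or> (let H = stab (SigmaN n S) in
        H \<noteq> {0} \<and>
        (\<exists>x A. setpartition A n \<and> seqOf A n \<subseteq># S \<and> size (seqOf A n) = n + m \<and>
          sumset A {1..n} = SigmaN n S \<and>
          set_mset (S - seqOf A n) \<subseteq> (\<lambda>h. x + h) ` H \<and>
          (\<forall>i\<in>{1..n}. card (A i) \<le> 2 \<and> ((\<lambda>h. x + h) ` H) \<inter> A i \<noteq> {}) \<and>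
          (\<exists>j\<in>{1..n}. card (sumset A {1..n}) = card (sumset A ({1..n} - {j})))))"
proof -
  define m where "m = min n (min (size S - n) (size S - hS S))"
  have mn: "m \<le> n" and mS: "n + m \<le> size S" and mh: "m + hS S \<le> size S"
    using assms(2) hS_le_size[of S] by (auto simp: m_def)
  have Sig_le: "card (SigmaN n S) \<le> m + 1" using assms(3) by (simp add: m_def)
  have bound: "card (psum P) \<le> card (SigmaN n S)" if P: "pairing S m P" for P
  proof -
    obtain t where "(+) t ` psum P \<subseteq> SigmaN n S"
      using ex_translate_subset_SigmaN[OF P mn mS] by blast
    from card_mono[OF finite_SigmaN this] show ?thesis by simp
  qed
  have full: "psum P' \<subseteq> psum P" if P: "pairing S m P" and c: "card (psum P) = m + 1" and P': "terms P' = terms P" for P P'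
  proof -
    obtain t where t: "\<And>P'. terms P' = terms P \<Longrightarrow> (+) t ` psum P' \<subseteq> SigmaN n S"
      using ex_translate_subset_SigmaN[OF P mn mS] by blast
    have "(+) t ` psum P = SigmaN n S"
      by (rule card_seteq[OF finite_SigmaN t]) (use Sig_le c in auto)
    then have "(+) t ` psum P' \<subseteq> (+) t ` psum P" using t[OF P'] by simp
    then show ?thesis by (simp add: inj_image_subset_iff)
  qed
  have ex: "\<exists>P. pairing S m P" by (rule ex_pairing) (use mn mS mh in auto)
  have three: "\<exists>u v w. u \<in># S \<and> v \<in># S \<and> w \<in># S \<and> u \<noteq> v \<and> u \<noteq> w \<and> v \<noteq> w" if "\<not> card (set_mset S) \<le> 2"
  proof -
    have "3 \<le> card (set_mset S)" using that by simp
    then obtain T where "T \<subseteq> set_mset S" "card T = 3" by (metis obtain_subset_with_card_n)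
    then show ?thesis by (auto simp: card_3_iff)
  qed
  consider "m = 0" | "m = 1" | "2 \<le> m" by linarith
  then show ?thesis
  proof cases
    case 1
    \<comment> \<open>Both \<open>n\<close> and \<open>size S - n\<close> are positive, so the
      vanishing minimum is \<open>size S - hS S\<close>.\<close>
    then have h: "hS S = size S" using assms(1,2) hS_le_size[of S] by (auto simp: m_def min_def split: if_splits)
    have "S \<noteq> {#}" using assms(2) by auto
    then obtain x where x: "x \<in># S" "count S x = size S" using hS_attained h by metis
    have "replicate_mset (size S) x \<subseteq># S" using x by (auto simp: subseteq_mset_def)
    then have "replicate_mset (size S) x = S" by (rule submset_eq_of_size) simp
    then have "set_mset S = {x}" using x(1) by (metis set_mset_replicate_mset_subset set_mset_empty empty_iff)
    then have "card (set_mset S) = 1" by simp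
    then show ?thesis unfolding Let_def by linarith
  next
    case 2
    obtain P where P: "pairing S m P" using ex by blast
    then have "size P = 1" using 2 by (simp add: pairing_def)
    then obtain p where p: "P = {#p#}" using size_1_singleton_mset by blast
    have pd: "fst p \<noteq> snd p" using P p by (simp add: pairing_def)
    \<comment> \<open>One pair of distinct terms already gives the two permitted sums, so a third
      distinct value in \<open>S\<close> would give one too many.\<close>
    have "pair_diff p \<notin> stab (psum {#})" using pd by (auto simp: stab_def pair_diff_def)
    from card_psum_add_less[OF this] have "2 \<le> card (psum P)" by (simp add: p)
    then have c: "card (SigmaN n S) = m + 1" using bound[OF P] Sig_le 2 by simp
    have "card (set_mset S) \<le> 2"
    proof (rule ccontr)
      assume "\<not> card (set_mset S) \<le> 2"
      then obtain u v w where "u \<in># S" "v \<in># S" "w \<in># S" "u \<noteq> v" "u \<noteq> w" "v \<noteq> w" using three by blast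
      from card_SigmaN_ge_3[OF assms(1,2) this] show False using c 2 by simp
    qed
    then show ?thesis using c unfolding Let_def m_def[symmetric] by blast
  next
    case 3
    define mx where "mx = Max ((\<lambda>P. card (psum P)) ` {P. pairing S m P})"
    have fin: "finite ((\<lambda>P. card (psum P)) ` {P. pairing S m P})"
      by (rule finite_subset[of _ "{..m + 1}"]) (use bound Sig_le le_trans in fastforce)+
    have mx: "card (psum P) \<le> mx" if "pairing S m P" for P
      unfolding mx_def using fin that by (intro Max_ge) auto
    have "mx \<in> (\<lambda>P. card (psum P)) ` {P. pairing S m P}"
      unfolding mx_def using fin ex by (intro Max_in) auto
    then obtain P0 where P0: "pairing S m P0" "card (psum P0) = mx" by auto
    have mx_le: "mx \<le> m + 1" using bound[OF P0(1)] P0(2) Sig_le by simp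
    show ?thesis
    proof (cases "\<exists>P. pairing S m P \<and> card (psum P) = mx \<and> redundant P")
      case True
      define good where "good P \<longleftrightarrow> pairing S m P \<and> card (psum P) = mx \<and> redundant P" for P
      \<comment> \<open>This bound makes the second extremal choice possible: among redundant
        pairings with the most sums, one with the most split pairs exists.\<close>
      have "num_outside P \<le> m" if "good P" for P
        using that size_filter_mset_lesseq by (metis good_def pairing_def num_outside_def)
      then obtain P where P: "good P" "\<And>P'. good P' \<Longrightarrow> num_outside P' \<le> num_outside P"
        using True ex_has_greatest_nat[of good _ num_outside "Suc m"] unfolding good_def
        by (metis le_imp_less_Suc)
      interpret extremal_pairing S m P
      proof
        show "pairing S m P" "redundant P" using P(1) by (auto simp: good_def)
        show "card (psum P') \<le> card (psum P)" if "pairing S m P'" for P'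
          using mx[OF that] P(1) by (simp add: good_def)
        show "card (psum P) \<le> m + 1" using mx_le P(1) by (simp add: good_def)
        show "num_outside P' \<le> num_outside P" if "pairing S m P'" "card (psum P') = card (psum P)" "redundant P'" for P'
          using P that by (simp add: good_def)
        show "psum P' \<subseteq> psum P" if "card (psum P) = m + 1" "terms P' = terms P" for P'
          using full that P(1) by (simp add: good_def)
      qed
      from klein_or_coset show ?thesis
      proof
        assume "\<exists>a g y. klein a g y"
        then obtain a g y where k: "m = 2" "S = {#a, a + g, a + y, a + y + g#}" "g \<noteq> 0" "y \<noteq> 0" "y \<noteq> g"
          "g + g = 0" "y + y = 0" by (auto simp: klein_def)
        have yg: "y + g \<noteq> 0" using k(5-7) by (metis add_left_cancel)
        have supp: "set_mset S = {a, a + g, a + y, a + y + g}" using k(2) by auto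
        have card: "card (set_mset S) = 4" unfolding supp using k(3-5) yg by (simp add: add.assoc)
        have sz: "size S = 4" using k(2) by simp
        \<comment> \<open>Here \<open>n + 2\<close> is at most 4 and \<open>n\<close> is at least
          \<open>m = 2\<close>.\<close>
        then have n2: "n = 2" using mn mS k(1) by simp
        have "3 \<le> card (SigmaN n S)"
          by (rule card_SigmaN_ge_3[OF assms(1,2), of a "a + g" "a + y"]) (use k in auto)
        then have c: "card (SigmaN n S) = m + 1" using Sig_le k(1) by simp
        show ?thesis
          using n2 sz card c coset_klein_four[OF k(3-7), of a]
          unfolding Let_def m_def[symmetric] supp by metis
      next
        assume "\<exists>x. (\<forall>p\<in>#P. fst p - x \<in> stab (psum P) \<or> snd p - x \<in> stab (psum P)) \<and>
          (\<forall>c\<in>#S - terms P. c - x \<in> stab (psum P))"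
        then obtain x where x: "\<forall>p\<in>#P. fst p - x \<in> stab (psum P) \<or> snd p - x \<in> stab (psum P)"
          "\<forall>c\<in>#S - terms P. c - x \<in> stab (psum P)" by blast
        obtain j B where j: "P = add_mset j B" "pair_diff j \<in> stab (psum B)"
          using red unfolding redundant_def by (metis insert_DiffM)
        show ?thesis
          unfolding Let_def m_def[symmetric]
          by (rule disjI2, rule setpartition_of_pairing[OF pairing mn mS j x])
      qed
    next
      case False
      then have "\<not> redundant P0" using P0 by blast
      then have "m + 1 \<le> card (psum P0)"
        using card_psum_not_redundant_ge P0(1) by (metis pairing_def)
      then have mx_eq: "mx = m + 1" using P0(2) mx_le by simp
      interpret tight_pairing S m P0
      proof
        show "pairing S m P0" "2 \<le> m" "card (psum P0) = m + 1" using P0 3 mx_eq by auto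
        show "card (psum P') \<le> m + 1" if "pairing S m P'" for P' using mx[OF that] mx_eq by simp
        show "\<not> redundant P'" if "pairing S m P'" "card (psum P') = m + 1" for P'
          using False that mx_eq by blast
        show "psum P' \<subseteq> psum P0" if "terms P' = terms P0" for P'
          using full[OF P0(1) _ that] P0(2) mx_eq by simp
      qed
      have c: "card (SigmaN n S) = m + 1" using bound[OF P0(1)] P0(2) mx_eq Sig_le by simp
      from supp_structure show ?thesis
      proof (elim disjE)
        assume "m = 2 \<and> (\<exists>x d. d + d \<noteq> 0 \<and> d + d + d = 0 \<and> set_mset S = {x, x + d, x + d + d})"
        then obtain x d where xd: "m = 2" "d + d \<noteq> 0" "d + d + d = 0" "set_mset S = {x, x + d, x + d + d}"
          by blast
        show ?thesis
          using xd(1) c coset_order_3[OF xd(2,3), of x]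
          unfolding Let_def m_def[symmetric] xd(4) by metis
      next
        assume "card (set_mset S) \<le> 2"
        then show ?thesis using c unfolding Let_def m_def[symmetric] by blast
      next
        assume "\<exists>x d. set_mset S \<subseteq> {x - d, x, x + d} \<and> count S x = size S - m"
        then obtain x d where xd: "set_mset S \<subseteq> {x - d, x, x + d}" "count S x = size S - m" by blast
        \<comment> \<open>The definition of \<open>m\<close> gives
          \<open>hS S <= size S - m\<close>, so a term of multiplicity \<open>size S - m\<close> has
          maximal multiplicity.\<close>
        have "count S x = hS S" using count_le_hS[of S x] mh xd(2) by simp
        then have "\<exists>x d. set_mset S \<subseteq> {x - d, x, x + d} \<and> count S x = hS S \<and> size S - m \<le> hS S"
          using xd by (metis order_refl)
        then show ?thesis using c unfolding Let_def m_def[symmetric] by blast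
      qed
    qed
  qed
qed

end
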